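(* Let $\mathcal{E}$ be a cocomplete closed symmetric monoidal category with tensor product $\otimes$, unit $I$ and internal hom $\operatorname{Hom}_{\mathcal{E}}(-,-)$. Then there is a one to one correspondence between the following classes: (i) Solid monoids (in $\mathcal{E}$). (ii) Smashing localization functors (in $\mathcal{E}$). (iii) Mapping colocalization functors (in $\mathcal{E}$).
   Context: A monoid $(R,\mu,\eta)$ in $\mathcal{E}$ (an object $R$ with multiplication $\mu\colon R\otimes R\to R$ and unit $\eta\colon I\to R$, associative and unital) is called solid if $\mu$ is an isomorphism. A localization functor in $\mathcal{E}$ is a functor $L\colon\mathcal{E}\to\mathcal{E}$ with a natural transformation $l\colon \mathrm{Id}\to L$ such that $l_{LX}=Ll_X$ and $l_{LX}$ is an isomorphism for every $X$. A colocalization functor in $\mathcal{E}$ is a functor $C\colon\mathcal{E}\to\mathcal{E}$ with a natural transformation $c\colon C\to\mathrm{Id}$ such that $c_{CX}=Cc_X$ and $c_{CX}$ is an isomorphism for every $X$. A localization functor $(L,l)$ is called smashing if there is an object $A$ in $\mathcal{E}$ such that $LX=X\otimes A$ for every $X$. A colocalization functor $(C,c)$ is called mapping if there is an object $A$ in $\mathcal{E}$ such that $CX=\operatorname{Hom}_{\mathcal{E}}(A,X)$ for every $X$. *)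

theory Defs
  imports Main
begin

section \<open>Categories, functors, natural transformations\<close>

record ('o, 'm) category =
  Obj  :: "'o set"
  Arr  :: "'m set"
  Dom  :: "'m \<Rightarrow> 'o"
  Cod  :: "'m \<Rightarrow> 'o"
  Id   :: "'o \<Rightarrow> 'm"
  Comp :: "'m \<Rightarrow> 'm \<Rightarrow> 'm"  (infixl "\<cdot>\<index>" 55)

text \<open>Composition is in applicative order: \<open>g \<cdot> f\<close> is \<open>f\<close> followed by \<open>g\<close>.\<close>

definition hom :: "('o, 'm, 'z) category_scheme \<Rightarrow> 'o \<Rightarrow> 'o \<Rightarrow> 'm set" where
  "hom E X Y = {f \<in> Arr E. Dom E f = X \<and> Cod E f = Y}"

locale category =
  fixes E :: "('o, 'm, 'z) category_scheme" (structure)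
  assumes Dom_in_Obj: "f \<in> Arr E \<Longrightarrow> Dom E f \<in> Obj E"
    and Cod_in_Obj: "f \<in> Arr E \<Longrightarrow> Cod E f \<in> Obj E"
    and Id_in_hom: "X \<in> Obj E \<Longrightarrow> Id E X \<in> hom E X X"
    and Comp_in_hom: "f \<in> hom E X Y \<Longrightarrow> g \<in> hom E Y Z \<Longrightarrow> g \<cdot> f \<in> hom E X Z"
    and Comp_Id: "f \<in> hom E X Y \<Longrightarrow> f \<cdot> Id E X = f"
    and Id_Comp: "f \<in> hom E X Y \<Longrightarrow> Id E Y \<cdot> f = f"
    and Comp_assoc: "f \<in> hom E W X \<Longrightarrow> g \<in> hom E X Y \<Longrightarrow> h \<in> hom E Y Z \<Longrightarrow>
          (h \<cdot> g) \<cdot> f = h \<cdot> (g \<cdot> f)"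

definition inverse_arrows :: "('o, 'm, 'z) category_scheme \<Rightarrow> 'm \<Rightarrow> 'm \<Rightarrow> bool" where
  "inverse_arrows E f g \<longleftrightarrow>
     f \<in> Arr E \<and> g \<in> hom E (Cod E f) (Dom E f) \<and>
     g \<cdot>\<^bsub>E\<^esub> f = Id E (Dom E f) \<and> f \<cdot>\<^bsub>E\<^esub> g = Id E (Cod E f)"

definition iso :: "('o, 'm, 'z) category_scheme \<Rightarrow> 'm \<Rightarrow> bool" where
  "iso E f \<longleftrightarrow> (\<exists>g. inverse_arrows E f g)"

definition inv_arrow :: "('o, 'm, 'z) category_scheme \<Rightarrow> 'm \<Rightarrow> 'm" where
  "inv_arrow E f = (THE g. inverse_arrows E f g)"

record ('o, 'm, 'p, 'n) fun_data =
  omap :: "'o \<Rightarrow> 'p"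
  amap :: "'m \<Rightarrow> 'n"

definition is_functor ::
  "('o, 'm, 'z) category_scheme \<Rightarrow> ('p, 'n, 'y) category_scheme \<Rightarrow>
   ('o, 'm, 'p, 'n) fun_data \<Rightarrow> bool" where
  "is_functor C D F \<longleftrightarrow>
     (\<forall>X \<in> Obj C. omap F X \<in> Obj D) \<and>
     (\<forall>X Y. \<forall>f \<in> hom C X Y. amap F f \<in> hom D (omap F X) (omap F Y)) \<and>
     (\<forall>X \<in> Obj C. amap F (Id C X) = Id D (omap F X)) \<and>
     (\<forall>X Y Z. \<forall>f \<in> hom C X Y. \<forall>g \<in> hom C Y Z.
        amap F (g \<cdot>\<^bsub>C\<^esub> f) = amap F g \<cdot>\<^bsub>D\<^esub> amap F f)"

definition nat_trans ::
  "('o, 'm, 'z) category_scheme \<Rightarrow> ('p, 'n, 'y) category_scheme \<Rightarrow>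
   ('o, 'm, 'p, 'n) fun_data \<Rightarrow> ('o, 'm, 'p, 'n) fun_data \<Rightarrow> ('o \<Rightarrow> 'n) \<Rightarrow> bool" where
  "nat_trans C D F G t \<longleftrightarrow>
     (\<forall>X \<in> Obj C. t X \<in> hom D (omap F X) (omap G X)) \<and>
     (\<forall>X Y. \<forall>f \<in> hom C X Y. amap G f \<cdot>\<^bsub>D\<^esub> t X = t Y \<cdot>\<^bsub>D\<^esub> amap F f)"

definition id_fun :: "('o, 'm, 'o, 'm) fun_data" where
  "id_fun = \<lparr>omap = (\<lambda>X. X), amap = (\<lambda>f. f)\<rparr>"


section \<open>Cocompleteness\<close>

definition cocone ::
  "('i, 'j, 'z) category_scheme \<Rightarrow> ('o, 'm, 'y) category_scheme \<Rightarrow>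
   ('i, 'j, 'o, 'm) fun_data \<Rightarrow> 'o \<Rightarrow> ('i \<Rightarrow> 'm) \<Rightarrow> bool" where
  "cocone J E D X t \<longleftrightarrow>
     X \<in> Obj E \<and>
     (\<forall>i \<in> Obj J. t i \<in> hom E (omap D i) X) \<and>
     (\<forall>i j. \<forall>u \<in> hom J i j. t j \<cdot>\<^bsub>E\<^esub> amap D u = t i)"

definition colimit ::
  "('i, 'j, 'z) category_scheme \<Rightarrow> ('o, 'm, 'y) category_scheme \<Rightarrow>
   ('i, 'j, 'o, 'm) fun_data \<Rightarrow> 'o \<Rightarrow> ('i \<Rightarrow> 'm) \<Rightarrow> bool" where
  "colimit J E D X t \<longleftrightarrow>
     cocone J E D X t \<and>
     (\<forall>Y s. cocone J E D Y s \<longrightarrow>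
        (\<exists>!h. h \<in> hom E X Y \<and> (\<forall>i \<in> Obj J. h \<cdot>\<^bsub>E\<^esub> t i = s i)))"

text \<open>
  Cocomplete means having all small colimits. Since HOL has no distinguished universe of
  small sets, smallness is relative to a type \<open>'s\<close>: a category is small if its objects and its
  arrows form subsets of \<open>'s\<close>. The type \<open>'s\<close> is unrelated to the types of objects and arrows of
  \<open>E\<close>, so no size restriction is put on \<open>E\<close>; theorems are to be stated for arbitrary \<open>'s\<close>.
\<close>
definition cocomplete :: "'s itself \<Rightarrow> ('o, 'm, 'z) category_scheme \<Rightarrow> bool" where
  "cocomplete u E \<longleftrightarrow>
     (\<forall>(J :: ('s, 's) category) (D :: ('s, 's, 'o, 'm) fun_data).
        category J \<and> is_functor J E D \<longrightarrow> (\<exists>X t. colimit J E D X t))"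


section \<open>Closed symmetric monoidal categories\<close>

record ('o, 'm) csm_category = "('o, 'm) category" +
  tensor   :: "'o \<Rightarrow> 'o \<Rightarrow> 'o"  (infixl "\<otimes>\<index>" 70)
  tensor_a :: "'m \<Rightarrow> 'm \<Rightarrow> 'm"  (infixl "\<boxtimes>\<index>" 70)
  unit_ob  :: "'o"  ("\<I>\<index>")
  assoc    :: "'o \<Rightarrow> 'o \<Rightarrow> 'o \<Rightarrow> 'm"
  lunit    :: "'o \<Rightarrow> 'm"
  runit    :: "'o \<Rightarrow> 'm"
  braid    :: "'o \<Rightarrow> 'o \<Rightarrow> 'm"
  ihom     :: "'o \<Rightarrow> 'o \<Rightarrow> 'o"
  ev       :: "'o \<Rightarrow> 'o \<Rightarrow> 'm"

text \<open>
  \<open>\<otimes>\<close> and \<open>\<boxtimes>\<close> are the object and the arrow part of the tensor product. The components of the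
  structure isomorphisms are \<open>assoc X Y Z : (X \<otimes> Y) \<otimes> Z \<rightarrow> X \<otimes> (Y \<otimes> Z)\<close>, \<open>lunit X : I \<otimes> X \<rightarrow> X\<close>,
  \<open>runit X : X \<otimes> I \<rightarrow> X\<close> and \<open>braid X Y : X \<otimes> Y \<rightarrow> Y \<otimes> X\<close>. The internal hom \<open>ihom A X\<close> is
  \<open>Hom(A, X)\<close>; the functor \<open>Hom(A, -)\<close> right adjoint to \<open>- \<otimes> A\<close> is presented by its counit
  \<open>ev A X : Hom(A, X) \<otimes> A \<rightarrow> X\<close>.
\<close>

locale symmetric_monoidal_category = category E
  for E :: "('o, 'm, 'z) csm_category_scheme" (structure) +
  assumes tensor_in_Obj: "X \<in> Obj E \<Longrightarrow> Y \<in> Obj E \<Longrightarrow> X \<otimes> Y \<in> Obj E"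
    and tensor_in_hom: "f \<in> hom E X Y \<Longrightarrow> g \<in> hom E X' Y' \<Longrightarrow>
          f \<boxtimes> g \<in> hom E (X \<otimes> X') (Y \<otimes> Y')"
    and tensor_Id: "X \<in> Obj E \<Longrightarrow> Y \<in> Obj E \<Longrightarrow> Id E X \<boxtimes> Id E Y = Id E (X \<otimes> Y)"
    and tensor_Comp: "f \<in> hom E X Y \<Longrightarrow> g \<in> hom E Y Z \<Longrightarrow>
          f' \<in> hom E X' Y' \<Longrightarrow> g' \<in> hom E Y' Z' \<Longrightarrow>
          (g \<cdot> f) \<boxtimes> (g' \<cdot> f') = (g \<boxtimes> g') \<cdot> (f \<boxtimes> f')"
    and unit_in_Obj: "\<I> \<in> Obj E"
    and assoc_in_hom: "X \<in> Obj E \<Longrightarrow> Y \<in> Obj E \<Longrightarrow> Z \<in> Obj E \<Longrightarrow>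
          assoc E X Y Z \<in> hom E ((X \<otimes> Y) \<otimes> Z) (X \<otimes> (Y \<otimes> Z))"
    and assoc_iso: "X \<in> Obj E \<Longrightarrow> Y \<in> Obj E \<Longrightarrow> Z \<in> Obj E \<Longrightarrow> iso E (assoc E X Y Z)"
    and assoc_natural: "f \<in> hom E X X' \<Longrightarrow> g \<in> hom E Y Y' \<Longrightarrow> h \<in> hom E Z Z' \<Longrightarrow>
          assoc E X' Y' Z' \<cdot> ((f \<boxtimes> g) \<boxtimes> h) = (f \<boxtimes> (g \<boxtimes> h)) \<cdot> assoc E X Y Z"
    and lunit_in_hom: "X \<in> Obj E \<Longrightarrow> lunit E X \<in> hom E (\<I> \<otimes> X) X"
    and lunit_iso: "X \<in> Obj E \<Longrightarrow> iso E (lunit E X)"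
    and lunit_natural: "f \<in> hom E X Y \<Longrightarrow> lunit E Y \<cdot> (Id E \<I> \<boxtimes> f) = f \<cdot> lunit E X"
    and runit_in_hom: "X \<in> Obj E \<Longrightarrow> runit E X \<in> hom E (X \<otimes> \<I>) X"
    and runit_iso: "X \<in> Obj E \<Longrightarrow> iso E (runit E X)"
    and runit_natural: "f \<in> hom E X Y \<Longrightarrow> runit E Y \<cdot> (f \<boxtimes> Id E \<I>) = f \<cdot> runit E X"
    and pentagon: "W \<in> Obj E \<Longrightarrow> X \<in> Obj E \<Longrightarrow> Y \<in> Obj E \<Longrightarrow> Z \<in> Obj E \<Longrightarrow>
          assoc E W X (Y \<otimes> Z) \<cdot> assoc E (W \<otimes> X) Y Z =
          (Id E W \<boxtimes> assoc E X Y Z) \<cdot> assoc E W (X \<otimes> Y) Z \<cdot> (assoc E W X Y \<boxtimes> Id E Z)"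
    and triangle: "X \<in> Obj E \<Longrightarrow> Y \<in> Obj E \<Longrightarrow>
          (Id E X \<boxtimes> lunit E Y) \<cdot> assoc E X \<I> Y = runit E X \<boxtimes> Id E Y"
    and braid_in_hom: "X \<in> Obj E \<Longrightarrow> Y \<in> Obj E \<Longrightarrow> braid E X Y \<in> hom E (X \<otimes> Y) (Y \<otimes> X)"
    and braid_natural: "f \<in> hom E X X' \<Longrightarrow> g \<in> hom E Y Y' \<Longrightarrow>
          braid E X' Y' \<cdot> (f \<boxtimes> g) = (g \<boxtimes> f) \<cdot> braid E X Y"
    and braid_symmetric: "X \<in> Obj E \<Longrightarrow> Y \<in> Obj E \<Longrightarrow>
          braid E Y X \<cdot> braid E X Y = Id E (X \<otimes> Y)"
    and hexagon: "X \<in> Obj E \<Longrightarrow> Y \<in> Obj E \<Longrightarrow> Z \<in> Obj E \<Longrightarrow>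
          assoc E Y Z X \<cdot> braid E X (Y \<otimes> Z) \<cdot> assoc E X Y Z =
          (Id E Y \<boxtimes> braid E X Z) \<cdot> assoc E Y X Z \<cdot> (braid E X Y \<boxtimes> Id E Z)"

locale closed_symmetric_monoidal_category = symmetric_monoidal_category +
  assumes ihom_in_Obj: "A \<in> Obj E \<Longrightarrow> X \<in> Obj E \<Longrightarrow> ihom E A X \<in> Obj E"
    and ev_in_hom: "A \<in> Obj E \<Longrightarrow> X \<in> Obj E \<Longrightarrow> ev E A X \<in> hom E (ihom E A X \<otimes> A) X"
    and ev_universal: "A \<in> Obj E \<Longrightarrow> X \<in> Obj E \<Longrightarrow> Z \<in> Obj E \<Longrightarrow> f \<in> hom E (Z \<otimes> A) X \<Longrightarrow>
          \<exists>!g. g \<in> hom E Z (ihom E A X) \<and> ev E A X \<cdot> (g \<boxtimes> Id E A) = f"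

definition curry_arrow ::
  "('o, 'm, 'z) csm_category_scheme \<Rightarrow> 'o \<Rightarrow> 'o \<Rightarrow> 'o \<Rightarrow> 'm \<Rightarrow> 'm" where
  "curry_arrow E Z A X f =
     (THE g. g \<in> hom E Z (ihom E A X) \<and> ev E A X \<cdot>\<^bsub>E\<^esub> (g \<boxtimes>\<^bsub>E\<^esub> Id E A) = f)"

definition tensor_fun ::
  "('o, 'm, 'z) csm_category_scheme \<Rightarrow> 'o \<Rightarrow> ('o, 'm, 'o, 'm) fun_data" where
  "tensor_fun E A = \<lparr>omap = (\<lambda>X. X \<otimes>\<^bsub>E\<^esub> A), amap = (\<lambda>f. f \<boxtimes>\<^bsub>E\<^esub> Id E A)\<rparr>"

definition ihom_fun ::
  "('o, 'm, 'z) csm_category_scheme \<Rightarrow> 'o \<Rightarrow> ('o, 'm, 'o, 'm) fun_data" where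
  "ihom_fun E A =
     \<lparr>omap = (\<lambda>X. ihom E A X),
      amap = (\<lambda>f. curry_arrow E (ihom E A (Dom E f)) A (Cod E f) (f \<cdot>\<^bsub>E\<^esub> ev E A (Dom E f)))\<rparr>"


section \<open>Solid monoids\<close>

record ('o, 'm) monoid_ob =
  carr :: "'o"
  mult :: "'m"
  unit :: "'m"

definition is_monoid :: "('o, 'm, 'z) csm_category_scheme \<Rightarrow> ('o, 'm) monoid_ob \<Rightarrow> bool" where
  "is_monoid E R \<longleftrightarrow>
     carr R \<in> Obj E \<and>
     mult R \<in> hom E (carr R \<otimes>\<^bsub>E\<^esub> carr R) (carr R) \<and>
     unit R \<in> hom E \<I>\<^bsub>E\<^esub> (carr R) \<and>
     mult R \<cdot>\<^bsub>E\<^esub> (mult R \<boxtimes>\<^bsub>E\<^esub> Id E (carr R)) =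
       mult R \<cdot>\<^bsub>E\<^esub> (Id E (carr R) \<boxtimes>\<^bsub>E\<^esub> mult R) \<cdot>\<^bsub>E\<^esub> assoc E (carr R) (carr R) (carr R) \<and>
     mult R \<cdot>\<^bsub>E\<^esub> (unit R \<boxtimes>\<^bsub>E\<^esub> Id E (carr R)) = lunit E (carr R) \<and>
     mult R \<cdot>\<^bsub>E\<^esub> (Id E (carr R) \<boxtimes>\<^bsub>E\<^esub> unit R) = runit E (carr R)"

definition solid_monoids :: "('o, 'm, 'z) csm_category_scheme \<Rightarrow> ('o, 'm) monoid_ob set" where
  "solid_monoids E = {R. is_monoid E R \<and> iso E (mult R)}"

definition monoid_iso_rel ::
  "('o, 'm, 'z) csm_category_scheme \<Rightarrow> (('o, 'm) monoid_ob \<times> ('o, 'm) monoid_ob) set" where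
  "monoid_iso_rel E =
     {(R, S). is_monoid E R \<and> is_monoid E S \<and>
        (\<exists>f \<in> hom E (carr R) (carr S). iso E f \<and>
           f \<cdot>\<^bsub>E\<^esub> mult R = mult S \<cdot>\<^bsub>E\<^esub> (f \<boxtimes>\<^bsub>E\<^esub> f) \<and> f \<cdot>\<^bsub>E\<^esub> unit R = unit S)}"


section \<open>Localization and colocalization functors\<close>

type_synonym ('o, 'm) endo_with_trans = "('o, 'm, 'o, 'm) fun_data \<times> ('o \<Rightarrow> 'm)"

definition localization ::
  "('o, 'm, 'z) category_scheme \<Rightarrow> ('o, 'm) endo_with_trans \<Rightarrow> bool" where
  "localization E = (\<lambda>(L, l).
     is_functor E E L \<and> nat_trans E E id_fun L l \<and>
     (\<forall>X \<in> Obj E. l (omap L X) = amap L (l X) \<and> iso E (l (omap L X))))"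

definition colocalization ::
  "('o, 'm, 'z) category_scheme \<Rightarrow> ('o, 'm) endo_with_trans \<Rightarrow> bool" where
  "colocalization E = (\<lambda>(C, c).
     is_functor E E C \<and> nat_trans E E C id_fun c \<and>
     (\<forall>X \<in> Obj E. c (omap C X) = amap C (c X) \<and> iso E (c (omap C X))))"

text \<open>
  HOL functions are total; equality of functors means agreement on the objects and arrows of the
  source category.
\<close>
definition eq_functor ::
  "('o, 'm, 'z) category_scheme \<Rightarrow>
   ('o, 'm, 'p, 'n) fun_data \<Rightarrow> ('o, 'm, 'p, 'n) fun_data \<Rightarrow> bool" where
  "eq_functor C F G \<longleftrightarrow>
     (\<forall>X \<in> Obj C. omap F X = omap G X) \<and> (\<forall>f \<in> Arr C. amap F f = amap G f)"

definition smashing_localizations ::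
  "('o, 'm, 'z) csm_category_scheme \<Rightarrow> ('o, 'm) endo_with_trans set" where
  "smashing_localizations E =
     {(L, l). localization E (L, l) \<and> (\<exists>A \<in> Obj E. eq_functor E L (tensor_fun E A))}"

definition mapping_colocalizations ::
  "('o, 'm, 'z) csm_category_scheme \<Rightarrow> ('o, 'm) endo_with_trans set" where
  "mapping_colocalizations E =
     {(C, c). colocalization E (C, c) \<and> (\<exists>A \<in> Obj E. eq_functor E C (ihom_fun E A))}"

definition localization_iso_rel ::
  "('o, 'm, 'z) category_scheme \<Rightarrow>
   (('o, 'm) endo_with_trans \<times> ('o, 'm) endo_with_trans) set" where
  "localization_iso_rel E =
     {((L, l), (L', l')). localization E (L, l) \<and> localization E (L', l') \<and>
        (\<exists>t. nat_trans E E L L' t \<and> (\<forall>X \<in> Obj E. iso E (t X) \<and> t X \<cdot>\<^bsub>E\<^esub> l X = l' X))}"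

definition colocalization_iso_rel ::
  "('o, 'm, 'z) category_scheme \<Rightarrow>
   (('o, 'm) endo_with_trans \<times> ('o, 'm) endo_with_trans) set" where
  "colocalization_iso_rel E =
     {((C, c), (C', c')). colocalization E (C, c) \<and> colocalization E (C', c') \<and>
        (\<exists>t. nat_trans E E C C' t \<and> (\<forall>X \<in> Obj E. iso E (t X) \<and> c' X \<cdot>\<^bsub>E\<^esub> t X = c X))}"


section \<open>The isomorphism classes\<close>

text \<open>
  The relations are defined between arbitrary monoids and (co)localizations; they are restricted
  here because the codomain of a quotient must consist of classes within the set considered.
  Functors with the same values on \<open>E\<close> are identified in the last two quotients.
\<close>

definition solid_iso :: 
  "('o, 'm, 'z) csm_category_scheme \<Rightarrow> (('o, 'm) monoid_ob \<times> ('o, 'm) monoid_ob) set" where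
  "solid_iso E = Restr (monoid_iso_rel E) (solid_monoids E)"

definition smashing_iso ::
  "('o, 'm, 'z) csm_category_scheme \<Rightarrow>
   (('o, 'm) endo_with_trans \<times> ('o, 'm) endo_with_trans) set" where
  "smashing_iso E = Restr (localization_iso_rel E) (smashing_localizations E)"

definition mapping_iso ::
  "('o, 'm, 'z) csm_category_scheme \<Rightarrow>
   (('o, 'm) endo_with_trans \<times> ('o, 'm) endo_with_trans) set" where
  "mapping_iso E = Restr (colocalization_iso_rel E) (mapping_colocalizations E)"


section \<open>The functors determined by a solid monoid\<close>

text \<open>
  For a monoid \<open>R\<close> with unit \<open>\<eta> : I \<rightarrow> R\<close>, the functor \<open>- \<otimes> R\<close> is coaugmented by
  \<open>X \<cong> X \<otimes> I \<rightarrow> X \<otimes> R\<close>, and \<open>Hom(R, -)\<close> is augmented by \<open>Hom(R, X) \<rightarrow> Hom(I, X) \<cong> X\<close>, which is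
  evaluation at \<open>\<eta>\<close>, that is, \<open>Hom(R, X) \<cong> Hom(R, X) \<otimes> I \<rightarrow> Hom(R, X) \<otimes> R \<rightarrow> X\<close>.
\<close>

definition smashing_of ::
  "('o, 'm, 'z) csm_category_scheme \<Rightarrow> ('o, 'm) monoid_ob \<Rightarrow> ('o, 'm) endo_with_trans" where
  "smashing_of E R =
     (tensor_fun E (carr R),
      \<lambda>X. (Id E X \<boxtimes>\<^bsub>E\<^esub> unit R) \<cdot>\<^bsub>E\<^esub> inv_arrow E (runit E X))"

definition mapping_of ::
  "('o, 'm, 'z) csm_category_scheme \<Rightarrow> ('o, 'm) monoid_ob \<Rightarrow> ('o, 'm) endo_with_trans" where
  "mapping_of E R =
     (ihom_fun E (carr R),
      \<lambda>X. ev E (carr R) X \<cdot>\<^bsub>E\<^esub> (Id E (ihom E (carr R) X) \<boxtimes>\<^bsub>E\<^esub> unit R) \<cdot>\<^bsub>E\<^esub>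
          inv_arrow E (runit E (ihom E (carr R) X)))"

end

theory Submission
  imports Defs
begin

text \<open>
  All three notions are the same as an idempotent object: an object \<open>A\<close> with an arrow
  \<open>\<eta> : \<I> \<rightarrow> A\<close> such that \<open>\<eta> \<otimes> A\<close> is invertible. By the symmetry \<open>A \<otimes> \<eta>\<close> is invertible
  too, and the two resulting isomorphisms \<open>A \<rightarrow> A \<otimes> A\<close> coincide (\<open>coaug_carrier\<close>): they agree
  on \<open>\<eta>\<close>, and an arrow from \<open>A\<close> to a local object, one for which \<open>X \<rightarrow> X \<otimes> A\<close> is invertible, is
  determined by its restriction along \<open>\<eta>\<close> (\<open>determined_on_unit\<close>).

  The unit of a solid monoid is idempotent by the left unit law. Conversely, the inverse of
  \<open>\<eta> \<otimes> A\<close> is a multiplication on \<open>A\<close> (\<open>solid_monoid_solid\<close>), and an arrow between solid monoids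
  that preserves the unit is all that is needed to compare them (\<open>solid_isoI\<close>,
  \<open>solid_iso_if_unital_maps\<close>).

  The coincidence of the two insertions of the unit is what makes \<open>- \<otimes> A\<close> a localization
  (\<open>coaug_tensor\<close>) and \<open>Hom(A, -)\<close> a colocalization (\<open>aug_ihom\<close>, \<open>iso_aug\<close>). In the other direction,
  let \<open>- \<otimes> A\<close> be a localization with coaugmentation \<open>l\<close>. Then \<open>l\<^sub>\<I> \<otimes> A\<close> is invertible, so \<open>l\<^sub>\<I>\<close> gives an
  idempotent object. If \<open>Hom(A, -)\<close> is a colocalization, then its augmentation \<open>c\<close> corresponds, by
  Yoneda, to an arrow \<open>\<eta> : \<I> \<rightarrow> A\<close>, and the invertibility of \<open>c\<close> on all \<open>Hom(A, Z)\<close> says that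
  \<open>\<eta> \<otimes> A\<close> induces bijections on arrows into every \<open>Z\<close> (\<open>mapping_colocalization_idempotent\<close>).

  In both cases the given transformation need not be the one defined by \<open>\<eta>\<close>, since a natural
  transformation is not determined by its component at \<open>\<I>\<close>. This does no harm: any two (co)augmentations that
  turn the same functor into a (co)localization are related by an automorphism of the functor
  (\<open>localization_unique_for_functor\<close>, \<open>colocalization_unique_for_functor\<close>).
\<close>

section \<open>Arrows and isomorphisms\<close>

context category
begin

lemma homD:
  assumes "f \<in> hom E X Y"
  shows "f \<in> Arr E" "Dom E f = X" "Cod E f = Y" "X \<in> Obj E" "Y \<in> Obj E"
  using assms Dom_in_Obj Cod_in_Obj by (auto simp: hom_def)

lemma homI: "f \<in> Arr E \<Longrightarrow> Dom E f = X \<Longrightarrow> Cod E f = Y \<Longrightarrow> f \<in> hom E X Y"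
  by (simp add: hom_def)

lemma Obj_Dom_Cod [simp]:
  assumes "f \<in> Arr E"
  shows "Dom E f \<in> Obj E" "Cod E f \<in> Obj E"
  using assms Dom_in_Obj Cod_in_Obj by auto

lemma Id_arrow [simp]:
  assumes "X \<in> Obj E"
  shows "Id E X \<in> Arr E" "Dom E (Id E X) = X" "Cod E (Id E X) = X"
  using homD[OF Id_in_hom[OF assms]] by auto

text \<open>
  Membership in \<open>Arr E\<close> together with equations for domain and codomain leaves no object
  to be guessed, so in this form the axioms work as conditional rewrite rules and composites
  are kept associated to the right.
\<close>
lemma Comp_arrow [simp]:
  assumes "f \<in> Arr E" "g \<in> Arr E" "Dom E g = Cod E f"
  shows "g \<cdot> f \<in> Arr E" "Dom E (g \<cdot> f) = Dom E f" "Cod E (g \<cdot> f) = Cod E g"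
proof -
  have "g \<cdot> f \<in> hom E (Dom E f) (Cod E g)"
    by (rule Comp_in_hom) (use assms in \<open>auto intro: homI\<close>)
  from homD[OF this]
  show "g \<cdot> f \<in> Arr E" "Dom E (g \<cdot> f) = Dom E f" "Cod E (g \<cdot> f) = Cod E g" by auto
qed

lemma Comp_Id_arrow [simp]: "f \<in> Arr E \<Longrightarrow> Dom E f = X \<Longrightarrow> f \<cdot> Id E X = f"
  by (rule Comp_Id) (auto intro: homI)

lemma Id_Comp_arrow [simp]: "f \<in> Arr E \<Longrightarrow> Cod E f = Y \<Longrightarrow> Id E Y \<cdot> f = f"
  by (rule Id_Comp) (auto intro: homI)

lemma Comp_assoc_arrow [simp]:
  "f \<in> Arr E \<Longrightarrow> g \<in> Arr E \<Longrightarrow> h \<in> Arr E \<Longrightarrow> Dom E g = Cod E f \<Longrightarrow> Dom E h = Cod E g \<Longrightarrow>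
     (h \<cdot> g) \<cdot> f = h \<cdot> (g \<cdot> f)"
  by (rule Comp_assoc) (auto intro: homI)

lemma inverse_arrows_inv_arrow:
  assumes "iso E f"
  shows "inverse_arrows E f (inv_arrow E f)"
proof -
  obtain g where g: "inverse_arrows E f g" using assms by (auto simp: iso_def)
  have "h = g" if h: "inverse_arrows E f h" for h
  proof -
    have [simp]: "f \<in> Arr E" "g \<in> Arr E" "h \<in> Arr E" "Dom E g = Cod E f" "Cod E g = Dom E f"
      "Dom E h = Cod E f" "Cod E h = Dom E f"
      using g h by (auto simp: inverse_arrows_def hom_def)
    have "h = h \<cdot> (f \<cdot> g)" using g by (simp add: inverse_arrows_def del: Comp_assoc_arrow)
    also have "\<dots> = (h \<cdot> f) \<cdot> g" by simp
    also have "\<dots> = g" using h by (simp add: inverse_arrows_def del: Comp_assoc_arrow)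
    finally show ?thesis .
  qed
  with g show ?thesis unfolding inv_arrow_def by (rule theI)
qed

lemma iso_arrow: "iso E f \<Longrightarrow> f \<in> Arr E"
  by (auto simp: iso_def inverse_arrows_def)

lemma inv_arrow [simp]:
  assumes "iso E f"
  shows "inv_arrow E f \<in> Arr E" "Dom E (inv_arrow E f) = Cod E f" "Cod E (inv_arrow E f) = Dom E f"
    "inv_arrow E f \<cdot> f = Id E (Dom E f)" "f \<cdot> inv_arrow E f = Id E (Cod E f)"
  using inverse_arrows_inv_arrow[OF assms] by (auto simp: inverse_arrows_def hom_def)

lemma inv_arrow_cancel [simp]:
  assumes "iso E f" "h \<in> Arr E"
  shows "Cod E h = Dom E f \<Longrightarrow> inv_arrow E f \<cdot> (f \<cdot> h) = h"
    and "Cod E h = Cod E f \<Longrightarrow> f \<cdot> (inv_arrow E f \<cdot> h) = h"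
proof -
  show "inv_arrow E f \<cdot> (f \<cdot> h) = h" if "Cod E h = Dom E f"
    using Comp_assoc_arrow[of h f "inv_arrow E f"] assms that by (simp add: iso_arrow del: Comp_assoc_arrow)
  show "f \<cdot> (inv_arrow E f \<cdot> h) = h" if "Cod E h = Cod E f"
    using Comp_assoc_arrow[of h "inv_arrow E f" f] assms that by (simp add: iso_arrow del: Comp_assoc_arrow)
qed

lemma isoI:
  assumes "f \<in> hom E X Y" "g \<in> hom E Y X" "g \<cdot> f = Id E X" "f \<cdot> g = Id E Y"
  shows "iso E f"
  using assms by (auto simp: iso_def inverse_arrows_def hom_def)

lemma iso_Id: "X \<in> Obj E \<Longrightarrow> iso E (Id E X)"
  by (rule isoI[of _ X X "Id E X"]) (auto intro: homI)

lemma iso_inv_arrow: "iso E f \<Longrightarrow> iso E (inv_arrow E f)"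
  by (rule isoI[of _ "Cod E f" "Dom E f" f]) (auto intro: homI simp: iso_arrow)

lemma iso_Comp:
  assumes "iso E f" "iso E g" "Dom E g = Cod E f"
  shows "iso E (g \<cdot> f)"
  by (rule isoI[of _ "Dom E f" "Cod E g" "inv_arrow E f \<cdot> inv_arrow E g"])
     (use assms in \<open>auto intro!: homI simp: iso_arrow\<close>)

lemma iso_cancel_left:
  assumes "iso E f" "a \<in> Arr E" "b \<in> Arr E" "Cod E a = Dom E f" "Cod E b = Dom E f" "f \<cdot> a = f \<cdot> b"
  shows "a = b"
  using inv_arrow_cancel(1)[OF assms(1,2,4)] inv_arrow_cancel(1)[OF assms(1,3,5)] assms(6) by metis

lemma iso_cancel_right:
  assumes "iso E f" "a \<in> Arr E" "b \<in> Arr E" "Dom E a = Cod E f" "Dom E b = Cod E f" "a \<cdot> f = b \<cdot> f"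
  shows "a = b"
proof -
  have "a = (a \<cdot> f) \<cdot> inv_arrow E f" using assms(1-5) by (simp add: iso_arrow)
  also have "\<dots> = b" unfolding assms(6) using assms(1-5) by (simp add: iso_arrow)
  finally show ?thesis .
qed

lemma iso_factor_left:
  assumes "iso E (g \<cdot> f)" "iso E f" "g \<in> Arr E" "Dom E g = Cod E f"
  shows "iso E g"
proof -
  have "(g \<cdot> f) \<cdot> inv_arrow E f = g" using assms by (simp add: iso_arrow)
  moreover have "iso E ((g \<cdot> f) \<cdot> inv_arrow E f)"
    by (rule iso_Comp) (use assms in \<open>auto intro: iso_inv_arrow simp: iso_arrow\<close>)
  ultimately show ?thesis by simp
qed

lemma iso_factor_right:
  assumes "iso E (g \<cdot> f)" "iso E g" "f \<in> Arr E" "Dom E g = Cod E f"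
  shows "iso E f"
proof -
  have "inv_arrow E g \<cdot> (g \<cdot> f) = f" using assms by (simp add: iso_arrow)
  moreover have "iso E (inv_arrow E g \<cdot> (g \<cdot> f))"
    by (rule iso_Comp) (use assms in \<open>auto intro: iso_inv_arrow simp: iso_arrow\<close>)
  ultimately show ?thesis by simp
qed

lemma inverse_square:
  assumes "iso E s" "iso E t" "f \<in> Arr E" "g \<in> Arr E" "Dom E f = Dom E s" "Dom E t = Cod E f"
    "Dom E g = Cod E s" "Cod E g = Cod E t" "g \<cdot> s = t \<cdot> f"
  shows "f \<cdot> inv_arrow E s = inv_arrow E t \<cdot> g"
proof (rule iso_cancel_left[OF assms(2)])
  have "t \<cdot> (f \<cdot> inv_arrow E s) = (t \<cdot> f) \<cdot> inv_arrow E s" using assms by (simp add: iso_arrow)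
  also have "\<dots> = g" unfolding assms(9)[symmetric] using assms(1-8) by (simp add: iso_arrow)
  finally show "t \<cdot> (f \<cdot> inv_arrow E s) = t \<cdot> (inv_arrow E t \<cdot> g)" using assms by (simp add: iso_arrow)
qed (use assms in \<open>auto simp: iso_arrow\<close>)

end

section \<open>Coherence of the unit isomorphisms\<close>

context symmetric_monoidal_category
begin

lemma tensor_Obj [simp]: "X \<in> Obj E \<Longrightarrow> Y \<in> Obj E \<Longrightarrow> X \<otimes> Y \<in> Obj E" "\<I> \<in> Obj E"
  by (rule tensor_in_Obj unit_in_Obj; assumption)+

lemma tensor_arrow [simp]:
  assumes "f \<in> Arr E" "g \<in> Arr E"
  shows "f \<boxtimes> g \<in> Arr E" "Dom E (f \<boxtimes> g) = Dom E f \<otimes> Dom E g" "Cod E (f \<boxtimes> g) = Cod E f \<otimes> Cod E g"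
  using homD[OF tensor_in_hom[OF homI[OF assms(1) refl refl] homI[OF assms(2) refl refl]]] by simp_all

lemma structure_arrows [simp]:
  assumes "X \<in> Obj E"
  shows "iso E (lunit E X)" "lunit E X \<in> Arr E" "Dom E (lunit E X) = \<I> \<otimes> X" "Cod E (lunit E X) = X"
    and "iso E (runit E X)" "runit E X \<in> Arr E" "Dom E (runit E X) = X \<otimes> \<I>" "Cod E (runit E X) = X"
    and "Y \<in> Obj E \<Longrightarrow> braid E X Y \<in> Arr E" "Y \<in> Obj E \<Longrightarrow> Dom E (braid E X Y) = X \<otimes> Y"
    and "Y \<in> Obj E \<Longrightarrow> Cod E (braid E X Y) = Y \<otimes> X"
    and "Y \<in> Obj E \<Longrightarrow> Z \<in> Obj E \<Longrightarrow> iso E (assoc E X Y Z)"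
    and "Y \<in> Obj E \<Longrightarrow> Z \<in> Obj E \<Longrightarrow> assoc E X Y Z \<in> Arr E"
    and "Y \<in> Obj E \<Longrightarrow> Z \<in> Obj E \<Longrightarrow> Dom E (assoc E X Y Z) = (X \<otimes> Y) \<otimes> Z"
    and "Y \<in> Obj E \<Longrightarrow> Z \<in> Obj E \<Longrightarrow> Cod E (assoc E X Y Z) = X \<otimes> (Y \<otimes> Z)"
  by (fact homD[OF lunit_in_hom[OF assms]] homD[OF runit_in_hom[OF assms]]
    homD[OF braid_in_hom[OF assms]] homD[OF assoc_in_hom[OF assms]]
    lunit_iso[OF assms] runit_iso[OF assms] assoc_iso[OF assms])+

lemma iso_braid [simp]: "X \<in> Obj E \<Longrightarrow> Y \<in> Obj E \<Longrightarrow> iso E (braid E X Y)"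
  by (rule isoI[of _ "X \<otimes> Y" "Y \<otimes> X" "braid E Y X"]) (auto intro: homI simp: braid_symmetric)

declare tensor_Id [simp]

lemma tensor_merge:
  assumes "f \<in> Arr E" "g \<in> Arr E" "f' \<in> Arr E" "g' \<in> Arr E" "Dom E g = Cod E f" "Dom E g' = Cod E f'"
  shows "(g \<boxtimes> g') \<cdot> (f \<boxtimes> f') = (g \<cdot> f) \<boxtimes> (g' \<cdot> f')"
  using assms by (intro tensor_Comp[symmetric]) (auto intro: homI)

lemma tensor_merge_assoc:
  assumes "f \<in> Arr E" "g \<in> Arr E" "f' \<in> Arr E" "g' \<in> Arr E" "Dom E g = Cod E f" "Dom E g' = Cod E f'"
    "h \<in> Arr E" "Cod E h = Dom E f \<otimes> Dom E f'"
  shows "(g \<boxtimes> g') \<cdot> ((f \<boxtimes> f') \<cdot> h) = ((g \<cdot> f) \<boxtimes> (g' \<cdot> f')) \<cdot> h"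
  using assms tensor_merge[OF assms(1-6)] Comp_assoc_arrow[of h "f \<boxtimes> f'" "g \<boxtimes> g'"]
  by (simp del: Comp_assoc_arrow)

lemmas merge = tensor_merge tensor_merge_assoc

lemma iso_tensor [simp]:
  assumes "iso E f" "iso E g"
  shows "iso E (f \<boxtimes> g)"
  by (rule isoI[of _ "Dom E f \<otimes> Dom E g" "Cod E f \<otimes> Cod E g" "inv_arrow E f \<boxtimes> inv_arrow E g"])
     (use assms in \<open>auto intro!: homI simp: iso_arrow merge\<close>)

declare iso_Id [simp]

lemma runit_nat: "f \<in> Arr E \<Longrightarrow> runit E (Cod E f) \<cdot> (f \<boxtimes> Id E \<I>) = f \<cdot> runit E (Dom E f)"
  by (rule runit_natural) (auto intro: homI)

lemma lunit_nat: "f \<in> Arr E \<Longrightarrow> lunit E (Cod E f) \<cdot> (Id E \<I> \<boxtimes> f) = f \<cdot> lunit E (Dom E f)"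
  by (rule lunit_natural) (auto intro: homI)

lemma assoc_nat:
  "f \<in> Arr E \<Longrightarrow> g \<in> Arr E \<Longrightarrow> h \<in> Arr E \<Longrightarrow>
     assoc E (Cod E f) (Cod E g) (Cod E h) \<cdot> ((f \<boxtimes> g) \<boxtimes> h) =
     (f \<boxtimes> (g \<boxtimes> h)) \<cdot> assoc E (Dom E f) (Dom E g) (Dom E h)"
  by (rule assoc_natural) (auto intro: homI)

lemma tensor_unit_faithful:
  assumes "f \<in> Arr E" "g \<in> Arr E" "Dom E g = Dom E f" "Cod E g = Cod E f"
    and "f \<boxtimes> Id E \<I> = g \<boxtimes> Id E \<I>"
  shows "f = g"
proof (rule iso_cancel_right)
  show "f \<cdot> runit E (Dom E f) = g \<cdot> runit E (Dom E f)"
    using runit_nat[of f] runit_nat[of g] assms by metis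
qed (simp_all add: assms)

text \<open>
  Tensoring with \<open>\<I>\<close> is faithful, since \<open>runit\<close> is a natural isomorphism, so the equation
  may be tested after tensoring with \<open>\<I>\<close>. There the triangle at \<open>(X \<otimes> Y, \<I>)\<close> introduces
  \<open>lunit E \<I>\<close>, the pentagon moves it to the inner pair \<open>(Y, \<I>)\<close>, and the triangle at \<open>(Y, \<I>)\<close>
  turns it back into \<open>runit E Y\<close> (Kelly's argument).
\<close>
lemma runit_tensor:
  assumes [simp]: "X \<in> Obj E" "Y \<in> Obj E"
  shows "runit E (X \<otimes> Y) = (Id E X \<boxtimes> runit E Y) \<cdot> assoc E X Y \<I>"
proof (rule tensor_unit_faithful)
  let ?i = "Id E \<I>" and ?a = "assoc E X Y \<I>"
  have "?a \<cdot> (runit E (X \<otimes> Y) \<boxtimes> ?i) =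
      ?a \<cdot> ((Id E X \<boxtimes> Id E Y) \<boxtimes> lunit E \<I>) \<cdot> assoc E (X \<otimes> Y) \<I> \<I>"
    using triangle[of "X \<otimes> Y" \<I>] by simp
  also have "?a \<cdot> ((Id E X \<boxtimes> Id E Y) \<boxtimes> lunit E \<I>) =
      (Id E X \<boxtimes> (Id E Y \<boxtimes> lunit E \<I>)) \<cdot> assoc E X Y (\<I> \<otimes> \<I>)"
    using assoc_nat[of "Id E X" "Id E Y" "lunit E \<I>"] by simp
  also have "\<dots> \<cdot> assoc E (X \<otimes> Y) \<I> \<I> =
      (Id E X \<boxtimes> (Id E Y \<boxtimes> lunit E \<I>)) \<cdot> (assoc E X Y (\<I> \<otimes> \<I>) \<cdot> assoc E (X \<otimes> Y) \<I> \<I>)"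
    by simp
  also have "\<dots> = (Id E X \<boxtimes> ((Id E Y \<boxtimes> lunit E \<I>) \<cdot> assoc E Y \<I> \<I>)) \<cdot>
      (assoc E X (Y \<otimes> \<I>) \<I> \<cdot> (?a \<boxtimes> ?i))"
    by (simp add: pentagon merge)
  also have "\<dots> = (Id E X \<boxtimes> (runit E Y \<boxtimes> ?i)) \<cdot> assoc E X (Y \<otimes> \<I>) \<I> \<cdot> (?a \<boxtimes> ?i)"
    by (simp add: triangle)
  also have "(Id E X \<boxtimes> (runit E Y \<boxtimes> ?i)) \<cdot> assoc E X (Y \<otimes> \<I>) \<I> =
      ?a \<cdot> ((Id E X \<boxtimes> runit E Y) \<boxtimes> ?i)"
    using assoc_nat[of "Id E X" "runit E Y" ?i] by simp
  also have "\<dots> \<cdot> (?a \<boxtimes> ?i) = ?a \<cdot> (((Id E X \<boxtimes> runit E Y) \<cdot> ?a) \<boxtimes> ?i)"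
    by (simp add: merge)
  finally have eq: "?a \<cdot> (runit E (X \<otimes> Y) \<boxtimes> ?i) = ?a \<cdot> (((Id E X \<boxtimes> runit E Y) \<cdot> ?a) \<boxtimes> ?i)" .
  show "runit E (X \<otimes> Y) \<boxtimes> ?i = ((Id E X \<boxtimes> runit E Y) \<cdot> ?a) \<boxtimes> ?i"
    by (rule iso_cancel_left[OF _ _ _ _ _ eq]) simp_all
qed auto

text \<open>
  Naturality of \<open>runit\<close> at \<open>runit E \<I>\<close> gives \<open>runit E (\<I> \<otimes> \<I>) = runit E \<I> \<boxtimes> Id E \<I>\<close>. By
  \<open>runit_tensor\<close> and the triangle, the two sides are \<open>Id E \<I> \<boxtimes> runit E \<I>\<close> and
  \<open>Id E \<I> \<boxtimes> lunit E \<I>\<close>, each followed by the associator.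
\<close>
lemma lunit_unit: "lunit E \<I> = runit E \<I>"
proof -
  let ?i = "Id E \<I>"
  have eq: "runit E \<I> \<cdot> runit E (\<I> \<otimes> \<I>) = runit E \<I> \<cdot> (runit E \<I> \<boxtimes> ?i)"
    using runit_nat[of "runit E \<I>"] by simp
  have "runit E (\<I> \<otimes> \<I>) = runit E \<I> \<boxtimes> ?i"
    by (rule iso_cancel_left[OF _ _ _ _ _ eq]) simp_all
  then have eq: "(?i \<boxtimes> runit E \<I>) \<cdot> assoc E \<I> \<I> \<I> = (?i \<boxtimes> lunit E \<I>) \<cdot> assoc E \<I> \<I> \<I>"
    using triangle[of \<I> \<I>] runit_tensor[of \<I> \<I>] by simp
  have "?i \<boxtimes> runit E \<I> = ?i \<boxtimes> lunit E \<I>"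
    by (rule iso_cancel_right[OF _ _ _ _ _ eq]) simp_all
  then have eq: "runit E \<I> \<cdot> lunit E (\<I> \<otimes> \<I>) = lunit E \<I> \<cdot> lunit E (\<I> \<otimes> \<I>)"
    using lunit_nat[of "runit E \<I>"] lunit_nat[of "lunit E \<I>"] by simp
  show ?thesis
    by (rule iso_cancel_right[OF _ _ _ _ _ eq[symmetric]]) simp_all
qed

lemma iso_tensor_assoc:
  assumes [simp]: "f \<in> Arr E" "g \<in> Arr E" "h \<in> Arr E" and "iso E (f \<boxtimes> (g \<boxtimes> h))"
  shows "iso E ((f \<boxtimes> g) \<boxtimes> h)"
proof (rule iso_factor_right)
  have "iso E ((f \<boxtimes> (g \<boxtimes> h)) \<cdot> assoc E (Dom E f) (Dom E g) (Dom E h))"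
    by (rule iso_Comp) (simp_all add: assms(4))
  then show "iso E (assoc E (Cod E f) (Cod E g) (Cod E h) \<cdot> ((f \<boxtimes> g) \<boxtimes> h))"
    by (simp only: assoc_nat assms)
qed simp_all

end

section \<open>Idempotent objects\<close>

context symmetric_monoidal_category
begin

text \<open>
  The coaugmentation \<open>X \<cong> X \<otimes> \<I> \<rightarrow> X \<otimes> A\<close> of the functor \<open>- \<otimes> A\<close> given by an arrow
  \<open>\<eta> : \<I> \<rightarrow> A\<close>. When it is invertible, \<open>X\<close> will be local.
\<close>
definition coaug :: "'m \<Rightarrow> 'o \<Rightarrow> 'm" where
  "coaug \<eta> X = (Id E X \<boxtimes> \<eta>) \<cdot> inv_arrow E (runit E X)"

lemma coaug_arrow [simp]:
  assumes "\<eta> \<in> Arr E" "Dom E \<eta> = \<I>" "X \<in> Obj E"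
  shows "coaug \<eta> X \<in> Arr E" "Dom E (coaug \<eta> X) = X" "Cod E (coaug \<eta> X) = X \<otimes> Cod E \<eta>"
  using assms by (simp_all add: coaug_def)

lemma coaug_nat:
  assumes [simp]: "\<eta> \<in> Arr E" "Dom E \<eta> = \<I>" "f \<in> Arr E"
  shows "(f \<boxtimes> Id E (Cod E \<eta>)) \<cdot> coaug \<eta> (Dom E f) = coaug \<eta> (Cod E f) \<cdot> f"
proof -
  let ?X = "Dom E f" and ?Y = "Cod E f"
  have "(f \<boxtimes> Id E \<I>) \<cdot> inv_arrow E (runit E ?X) = inv_arrow E (runit E ?Y) \<cdot> f"
    by (rule inverse_square) (simp_all add: runit_nat)
  moreover have "(f \<boxtimes> Id E (Cod E \<eta>)) \<cdot> coaug \<eta> ?X =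
      (Id E ?Y \<boxtimes> \<eta>) \<cdot> ((f \<boxtimes> Id E \<I>) \<cdot> inv_arrow E (runit E ?X))"
    by (simp add: coaug_def merge)
  ultimately show ?thesis by (simp add: coaug_def)
qed

lemma coaug_comp:
  assumes [simp]: "\<eta> \<in> Arr E" "Dom E \<eta> = \<I>" "f \<in> Arr E" "Dom E f = Cod E \<eta>" "X \<in> Obj E"
  shows "(Id E X \<boxtimes> f) \<cdot> coaug \<eta> X = coaug (f \<cdot> \<eta>) X"
  by (simp add: coaug_def merge)

lemma lunit_coaug_unit:
  assumes [simp]: "\<eta> \<in> Arr E" "Dom E \<eta> = \<I>"
  shows "lunit E (Cod E \<eta>) \<cdot> coaug \<eta> \<I> = \<eta>"
proof -
  have "lunit E (Cod E \<eta>) \<cdot> coaug \<eta> \<I> =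
      (lunit E (Cod E \<eta>) \<cdot> (Id E \<I> \<boxtimes> \<eta>)) \<cdot> inv_arrow E (runit E \<I>)"
    by (simp add: coaug_def)
  also have "\<dots> = (\<eta> \<cdot> lunit E \<I>) \<cdot> inv_arrow E (runit E \<I>)"
    by (simp only: lunit_nat assms)
  also have "\<dots> = \<eta>" by (simp add: lunit_unit)
  finally show ?thesis .
qed

lemma iso_coaug_iff:
  assumes [simp]: "\<eta> \<in> Arr E" "Dom E \<eta> = \<I>" "X \<in> Obj E"
  shows "iso E (coaug \<eta> X) \<longleftrightarrow> iso E (Id E X \<boxtimes> \<eta>)"
proof
  assume "iso E (coaug \<eta> X)"
  then show "iso E (Id E X \<boxtimes> \<eta>)"
    unfolding coaug_def by (rule iso_factor_left) (simp_all add: iso_inv_arrow)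
next
  assume "iso E (Id E X \<boxtimes> \<eta>)"
  then show "iso E (coaug \<eta> X)"
    unfolding coaug_def by (intro iso_Comp) (simp_all add: iso_inv_arrow)
qed

end

text \<open>
  Arrows \<open>\<eta> : \<I> \<rightarrow> A\<close> whose tensor product with \<open>A\<close> is invertible: the data that solid monoids,
  smashing localizations and mapping colocalizations have in common.
\<close>
locale idempotent_object = symmetric_monoidal_category E
  for E :: "('o, 'm, 'z) csm_category_scheme" (structure) +
  fixes A :: 'o and \<eta> :: 'm
  assumes unit_hom: "\<eta> \<in> hom E \<I> A"
    and iso_unit_tensor: "iso E (\<eta> \<boxtimes> Id E A)"
begin

lemma unit_arrow [simp]: "\<eta> \<in> Arr E" "Dom E \<eta> = \<I>" "Cod E \<eta> = A" "A \<in> Obj E"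
  using homD[OF unit_hom] by auto

lemma iso_tensor_unit: "iso E (Id E A \<boxtimes> \<eta>)"
proof (rule iso_factor_left)
  have "iso E (braid E A A \<cdot> (\<eta> \<boxtimes> Id E A))"
    by (rule iso_Comp) (simp_all add: iso_unit_tensor)
  then show "iso E ((Id E A \<boxtimes> \<eta>) \<cdot> braid E \<I> A)"
    using braid_natural[OF unit_hom Id_in_hom[of A]] by simp
qed simp_all

lemma iso_coaug_tensor:
  assumes [simp]: "X \<in> Obj E"
  shows "iso E (coaug \<eta> (X \<otimes> A))"
proof -
  have "iso E ((Id E X \<boxtimes> Id E A) \<boxtimes> \<eta>)"
    by (rule iso_tensor_assoc) (simp_all add: iso_tensor_unit del: tensor_Id)
  then show ?thesis by (simp add: iso_coaug_iff)
qed

text \<open>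
  The universal property of \<open>\<eta>\<close> as a localization of \<open>\<I>\<close>, uniqueness part: since
  \<open>\<eta> \<boxtimes> Id E A\<close> is invertible, \<open>f\<close> and \<open>g\<close> become equal after tensoring with \<open>A\<close>, and the
  naturality of \<open>coaug\<close> recovers them because the target is local.
\<close>
lemma determined_on_unit:
  assumes [simp]: "f \<in> hom E A Z" "g \<in> hom E A Z" and iso: "iso E (coaug \<eta> Z)"
    and eq: "f \<cdot> \<eta> = g \<cdot> \<eta>"
  shows "f = g"
proof -
  note [simp] = homD[OF assms(1)] homD[OF assms(2)]
  have "(f \<boxtimes> Id E A) \<cdot> (\<eta> \<boxtimes> Id E A) = (g \<boxtimes> Id E A) \<cdot> (\<eta> \<boxtimes> Id E A)"
    by (simp add: merge eq)
  then have "f \<boxtimes> Id E A = g \<boxtimes> Id E A"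
    by (rule iso_cancel_right[OF iso_unit_tensor, rotated -1]) simp_all
  then have "coaug \<eta> Z \<cdot> f = coaug \<eta> Z \<cdot> g"
    using coaug_nat[of \<eta> f] coaug_nat[of \<eta> g] by simp
  then show ?thesis
    by (rule iso_cancel_left[OF iso, rotated -1]) simp_all
qed

text \<open>
  The two insertions \<open>A \<rightarrow> A \<otimes> A\<close> of the unit agree: the target is local, so it suffices
  to compare them on \<open>\<eta>\<close>, where both are \<open>\<eta> \<boxtimes> \<eta>\<close> up to the identification of \<open>\<I> \<otimes> \<I>\<close>
  with \<open>\<I>\<close>, which is unambiguous by \<open>lunit_unit\<close>.
\<close>
lemma coaug_carrier: "coaug \<eta> A = (\<eta> \<boxtimes> Id E A) \<cdot> inv_arrow E (lunit E A)"
proof (rule determined_on_unit[where Z = "A \<otimes> A"])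
  have "coaug \<eta> A \<cdot> \<eta> = (\<eta> \<boxtimes> Id E A) \<cdot> coaug \<eta> \<I>"
    using coaug_nat[of \<eta> \<eta>] by simp
  also have "coaug \<eta> \<I> = inv_arrow E (lunit E A) \<cdot> \<eta>"
    by (rule iso_cancel_left[of "lunit E A"]) (use lunit_coaug_unit[of \<eta>] in simp_all)
  finally show "coaug \<eta> A \<cdot> \<eta> = ((\<eta> \<boxtimes> Id E A) \<cdot> inv_arrow E (lunit E A)) \<cdot> \<eta>" by simp
qed (simp_all add: homI iso_coaug_tensor)

lemma iso_coaug_carrier: "iso E (coaug \<eta> A)"
  by (simp add: iso_coaug_iff iso_tensor_unit)

text \<open>
  After rebracketing, the two sides insert \<open>\<eta>\<close> to the right and to the left of the last
  factor \<open>A\<close>, so the equation is \<open>Id E X\<close> tensored with \<open>coaug_carrier\<close>.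
\<close>
lemma coaug_tensor:
  assumes [simp]: "X \<in> Obj E"
  shows "coaug \<eta> (X \<otimes> A) = coaug \<eta> X \<boxtimes> Id E A"
proof -
  let ?a = "assoc E X A A"
  have "assoc E X A \<I> \<cdot> inv_arrow E (runit E (X \<otimes> A)) = Id E X \<boxtimes> inv_arrow E (runit E A)"
  proof (rule iso_cancel_left[of "Id E X \<boxtimes> runit E A"])
    have "(Id E X \<boxtimes> runit E A) \<cdot> (assoc E X A \<I> \<cdot> inv_arrow E (runit E (X \<otimes> A))) =
        runit E (X \<otimes> A) \<cdot> inv_arrow E (runit E (X \<otimes> A))"
      by (subst (2) runit_tensor) simp_all
    then show "(Id E X \<boxtimes> runit E A) \<cdot> (assoc E X A \<I> \<cdot> inv_arrow E (runit E (X \<otimes> A))) =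
        (Id E X \<boxtimes> runit E A) \<cdot> (Id E X \<boxtimes> inv_arrow E (runit E A))"
      by (simp add: merge)
  qed simp_all
  moreover have "?a \<cdot> (Id E (X \<otimes> A) \<boxtimes> \<eta>) = (Id E X \<boxtimes> (Id E A \<boxtimes> \<eta>)) \<cdot> assoc E X A \<I>"
    using assoc_nat[of "Id E X" "Id E A" \<eta>] by simp
  ultimately have 1: "?a \<cdot> coaug \<eta> (X \<otimes> A) = Id E X \<boxtimes> coaug \<eta> A"
    using Comp_assoc_arrow[of "inv_arrow E (runit E (X \<otimes> A))" "Id E (X \<otimes> A) \<boxtimes> \<eta>" ?a, symmetric]
    by (simp add: coaug_def merge)
  have "assoc E X \<I> A \<cdot> (inv_arrow E (runit E X) \<boxtimes> Id E A) = Id E X \<boxtimes> inv_arrow E (lunit E A)"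
  proof (rule iso_cancel_left[of "Id E X \<boxtimes> lunit E A"])
    have "(Id E X \<boxtimes> lunit E A) \<cdot> (assoc E X \<I> A \<cdot> (inv_arrow E (runit E X) \<boxtimes> Id E A)) =
        (runit E X \<boxtimes> Id E A) \<cdot> (inv_arrow E (runit E X) \<boxtimes> Id E A)"
      by (subst triangle[symmetric]) simp_all
    then show "(Id E X \<boxtimes> lunit E A) \<cdot> (assoc E X \<I> A \<cdot> (inv_arrow E (runit E X) \<boxtimes> Id E A)) =
        (Id E X \<boxtimes> lunit E A) \<cdot> (Id E X \<boxtimes> inv_arrow E (lunit E A))"
      by (simp add: merge)
  qed simp_all
  moreover have "?a \<cdot> ((Id E X \<boxtimes> \<eta>) \<boxtimes> Id E A) = (Id E X \<boxtimes> (\<eta> \<boxtimes> Id E A)) \<cdot> assoc E X \<I> A"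
    using assoc_nat[of "Id E X" \<eta> "Id E A"] by simp
  moreover have "coaug \<eta> X \<boxtimes> Id E A =
      ((Id E X \<boxtimes> \<eta>) \<boxtimes> Id E A) \<cdot> (inv_arrow E (runit E X) \<boxtimes> Id E A)"
    by (simp add: coaug_def merge)
  ultimately have 2: "?a \<cdot> (coaug \<eta> X \<boxtimes> Id E A) = Id E X \<boxtimes> coaug \<eta> A"
    using Comp_assoc_arrow[of "inv_arrow E (runit E X) \<boxtimes> Id E A" "(Id E X \<boxtimes> \<eta>) \<boxtimes> Id E A" ?a, symmetric]
    by (simp add: coaug_carrier merge)
  show ?thesis
    by (rule iso_cancel_left[of ?a]) (simp_all add: 1 2)
qed

end

section \<open>Solid monoids are idempotent objects\<close>

context symmetric_monoidal_category
begin

lemma solid_monoid_idempotent: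
  assumes "R \<in> solid_monoids E"
  shows "idempotent_object E (carr R) (unit R)"
proof
  have R: "is_monoid E R" and iso: "iso E (mult R)" using assms by (auto simp: solid_monoids_def)
  show u: "unit R \<in> hom E \<I> (carr R)" using R by (simp add: is_monoid_def)
  have m: "mult R \<in> hom E (carr R \<otimes> carr R) (carr R)" using R by (simp add: is_monoid_def)
  note [simp] = homD[OF u] homD[OF m]
  show "iso E (unit R \<boxtimes> Id E (carr R))"
    by (rule iso_factor_right[of "mult R"]) (use R iso in \<open>simp_all add: is_monoid_def\<close>)
qed

text \<open>
  An isomorphism compatible with the units is multiplicative: the two sides of the required equation
  agree after precomposition with \<open>unit R \<boxtimes> Id E (carr R)\<close> by the left unit laws, and that
  arrow is invertible.
\<close>
lemma solid_isoI:
  assumes R: "R \<in> solid_monoids E" and S: "S \<in> solid_monoids E"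
    and f: "f \<in> hom E (carr R) (carr S)" "iso E f" and eq: "f \<cdot> unit R = unit S"
  shows "(R, S) \<in> solid_iso E"
proof -
  interpret R: idempotent_object E "carr R" "unit R" using R by (rule solid_monoid_idempotent)
  interpret S: idempotent_object E "carr S" "unit S" using S by (rule solid_monoid_idempotent)
  have R': "is_monoid E R" and S': "is_monoid E S" using R S by (auto simp: solid_monoids_def)
  have mR: "mult R \<in> hom E (carr R \<otimes> carr R) (carr R)" and mS: "mult S \<in> hom E (carr S \<otimes> carr S) (carr S)"
    and uR: "mult R \<cdot> (unit R \<boxtimes> Id E (carr R)) = lunit E (carr R)"
    and uS: "mult S \<cdot> (unit S \<boxtimes> Id E (carr S)) = lunit E (carr S)"
    using R' S' by (auto simp: is_monoid_def)
  note [simp] = homD[OF mR] homD[OF mS] homD[OF f(1)]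
  have "f \<cdot> mult R = mult S \<cdot> (f \<boxtimes> f)"
  proof (rule iso_cancel_right[OF R.iso_unit_tensor])
    have "(mult S \<cdot> (f \<boxtimes> f)) \<cdot> (unit R \<boxtimes> Id E (carr R)) =
        (mult S \<cdot> (unit S \<boxtimes> Id E (carr S))) \<cdot> (Id E \<I> \<boxtimes> f)"
      by (simp add: merge eq)
    also have "\<dots> = f \<cdot> lunit E (carr R)" unfolding uS using lunit_nat[of f] by simp
    finally show "(f \<cdot> mult R) \<cdot> (unit R \<boxtimes> Id E (carr R)) = (mult S \<cdot> (f \<boxtimes> f)) \<cdot> (unit R \<boxtimes> Id E (carr R))"
      by (simp add: uR)
  qed simp_all
  with R R' S S' f eq show ?thesis by (auto simp: solid_iso_def monoid_iso_rel_def)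
qed

lemma solid_isoE:
  assumes "(R, S) \<in> solid_iso E"
  obtains f where "R \<in> solid_monoids E" "S \<in> solid_monoids E"
    "f \<in> hom E (carr R) (carr S)" "iso E f" "f \<cdot> unit R = unit S"
  using assms by (auto simp: solid_iso_def monoid_iso_rel_def)

lemma unital_endomorphism:
  assumes R: "R \<in> solid_monoids E" and f: "f \<in> hom E (carr R) (carr R)" "f \<cdot> unit R = unit R"
  shows "f = Id E (carr R)"
proof -
  interpret R: idempotent_object E "carr R" "unit R" using R by (rule solid_monoid_idempotent)
  show ?thesis
    by (rule R.determined_on_unit[OF f(1)]) (simp_all add: Id_in_hom R.iso_coaug_carrier f(2))
qed

text \<open>
  Both composites are endomorphisms that preserve the unit, hence identities. It is this
  criterion that lets an isomorphism of functors be turned into one of monoids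
  without proving that an induced arrow is invertible.
\<close>
lemma solid_iso_if_unital_maps:
  assumes R: "R \<in> solid_monoids E" and S: "S \<in> solid_monoids E"
    and f: "f \<in> hom E (carr R) (carr S)" "f \<cdot> unit R = unit S"
    and g: "g \<in> hom E (carr S) (carr R)" "g \<cdot> unit S = unit R"
  shows "(R, S) \<in> solid_iso E"
proof -
  interpret R: idempotent_object E "carr R" "unit R" using R by (rule solid_monoid_idempotent)
  interpret S: idempotent_object E "carr S" "unit S" using S by (rule solid_monoid_idempotent)
  note [simp] = homD[OF f(1)] homD[OF g(1)]
  have "g \<cdot> f = Id E (carr R)"
    by (rule unital_endomorphism[OF R]) (simp_all add: f(2) g(2) homI)
  moreover have "f \<cdot> g = Id E (carr S)"
    by (rule unital_endomorphism[OF S]) (simp_all add: f(2) g(2) homI)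
  ultimately have "iso E f" by (rule isoI[OF f(1) g(1)])
  then show ?thesis by (rule solid_isoI[OF R S f(1) _ f(2)])
qed

lemma equiv_solid_iso: "equiv (solid_monoids E) (solid_iso E)"
proof (rule equivI)
  show "solid_iso E \<subseteq> solid_monoids E \<times> solid_monoids E" by (auto simp: solid_iso_def)
  show "refl_on (solid_monoids E) (solid_iso E)"
  proof (rule refl_onI)
    fix R assume R: "R \<in> solid_monoids E"
    interpret R: idempotent_object E "carr R" "unit R" using R by (rule solid_monoid_idempotent)
    show "(R, R) \<in> solid_iso E"
      by (rule solid_isoI[OF R R Id_in_hom]) simp_all
  qed
  show "sym (solid_iso E)"
  proof (rule symI)
    fix R S assume "(R, S) \<in> solid_iso E"
    then obtain f where RS: "R \<in> solid_monoids E" "S \<in> solid_monoids E"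
      and f: "f \<in> hom E (carr R) (carr S)" "iso E f" and eq: "f \<cdot> unit R = unit S"
      by (rule solid_isoE)
    interpret R: idempotent_object E "carr R" "unit R" using RS(1) by (rule solid_monoid_idempotent)
    note [simp] = homD[OF f(1)] f(2)
    show "(S, R) \<in> solid_iso E"
      by (rule solid_isoI[OF RS(2,1), of "inv_arrow E f"])
         (simp_all add: homI iso_inv_arrow eq[symmetric])
  qed
  show "trans (solid_iso E)"
  proof (rule transI)
    fix R S T assume "(R, S) \<in> solid_iso E" "(S, T) \<in> solid_iso E"
    then obtain f g where RST: "R \<in> solid_monoids E" "S \<in> solid_monoids E" "T \<in> solid_monoids E"
      and f: "f \<in> hom E (carr R) (carr S)" "iso E f" "f \<cdot> unit R = unit S"
      and g: "g \<in> hom E (carr S) (carr T)" "iso E g" "g \<cdot> unit S = unit T"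
      by (elim solid_isoE)
    interpret R: idempotent_object E "carr R" "unit R" using RST(1) by (rule solid_monoid_idempotent)
    note [simp] = homD[OF f(1)] homD[OF g(1)]
    show "(R, T) \<in> solid_iso E"
      by (rule solid_isoI[OF RST(1,3), of "g \<cdot> f"]) (simp_all add: homI iso_Comp f g)
  qed
qed

end

context idempotent_object
begin

text \<open>
  The left unit law forces the multiplication to be this one.
\<close>
definition solid_monoid :: "('o, 'm) monoid_ob" where
  "solid_monoid =
     \<lparr>carr = A, mult = lunit E A \<cdot> inv_arrow E (\<eta> \<boxtimes> Id E A), unit = \<eta>\<rparr>"

lemma solid_monoid_simps [simp]: "carr solid_monoid = A" "unit solid_monoid = \<eta>"
  by (simp_all add: solid_monoid_def)

text \<open>
  The right unit law is the agreement of the two insertions of the unit. Associativity can be checked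
  after inserting \<open>\<eta>\<close> in the middle factor, which is an isomorphism; there the two
  unit laws and the triangle reduce both sides to \<open>\<mu> \<cdot> (runit E A \<boxtimes> Id E A)\<close>.
\<close>
lemma solid_monoid_solid: "solid_monoid \<in> solid_monoids E"
proof -
  let ?\<mu> = "lunit E A \<cdot> inv_arrow E (\<eta> \<boxtimes> Id E A)"
  note [simp] = iso_unit_tensor
  have left: "?\<mu> \<cdot> (\<eta> \<boxtimes> Id E A) = lunit E A" by simp
  have "Id E A \<boxtimes> \<eta> = coaug \<eta> A \<cdot> runit E A" by (simp add: coaug_def)
  then have right: "?\<mu> \<cdot> (Id E A \<boxtimes> \<eta>) = runit E A" by (simp add: coaug_carrier)
  have "?\<mu> \<cdot> (?\<mu> \<boxtimes> Id E A) = (?\<mu> \<cdot> (Id E A \<boxtimes> ?\<mu>)) \<cdot> assoc E A A A"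
  proof (rule iso_cancel_right[of "(Id E A \<boxtimes> \<eta>) \<boxtimes> Id E A"])
    \<comment> \<open>Naming the multiplication keeps the simplifier from reassociating it with its neighbours.\<close>
    define m where "m = ?\<mu>"
    have [simp]: "m \<in> Arr E" "Dom E m = A \<otimes> A" "Cod E m = A" by (simp_all add: m_def)
    have left': "m \<cdot> (\<eta> \<boxtimes> Id E A) = lunit E A" and right': "m \<cdot> (Id E A \<boxtimes> \<eta>) = runit E A"
      using left right by (simp_all only: m_def)
    have "((m \<cdot> (Id E A \<boxtimes> m)) \<cdot> assoc E A A A) \<cdot> ((Id E A \<boxtimes> \<eta>) \<boxtimes> Id E A) =
        m \<cdot> ((Id E A \<boxtimes> m) \<cdot> (assoc E A A A \<cdot> ((Id E A \<boxtimes> \<eta>) \<boxtimes> Id E A)))" by simp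
    also have "assoc E A A A \<cdot> ((Id E A \<boxtimes> \<eta>) \<boxtimes> Id E A) = (Id E A \<boxtimes> (\<eta> \<boxtimes> Id E A)) \<cdot> assoc E A \<I> A"
      using assoc_nat[of "Id E A" \<eta> "Id E A"] by simp
    also have "m \<cdot> ((Id E A \<boxtimes> m) \<cdot> \<dots>) = m \<cdot> ((Id E A \<boxtimes> lunit E A) \<cdot> assoc E A \<I> A)"
      by (simp add: merge left')
    also have "\<dots> = m \<cdot> (runit E A \<boxtimes> Id E A)" by (simp add: triangle)
    also have "\<dots> = (m \<cdot> (m \<boxtimes> Id E A)) \<cdot> ((Id E A \<boxtimes> \<eta>) \<boxtimes> Id E A)"
      by (simp add: merge right')
    finally show "(?\<mu> \<cdot> (?\<mu> \<boxtimes> Id E A)) \<cdot> ((Id E A \<boxtimes> \<eta>) \<boxtimes> Id E A) =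
        ((?\<mu> \<cdot> (Id E A \<boxtimes> ?\<mu>)) \<cdot> assoc E A A A) \<cdot> ((Id E A \<boxtimes> \<eta>) \<boxtimes> Id E A)"
      unfolding m_def by simp
  qed (simp_all add: iso_tensor_unit)
  moreover have "iso E ?\<mu>" by (rule iso_Comp) (simp_all add: iso_inv_arrow)
  ultimately show ?thesis
    using left right by (simp add: solid_monoids_def is_monoid_def solid_monoid_def homI unit_hom)
qed

end

section \<open>Natural isomorphisms of localizations\<close>

context category
begin

lemma functor_arrow:
  assumes "is_functor E E F"
  shows "X \<in> Obj E \<Longrightarrow> omap F X \<in> Obj E"
    and "f \<in> Arr E \<Longrightarrow> amap F f \<in> Arr E"
    and "f \<in> Arr E \<Longrightarrow> Dom E (amap F f) = omap F (Dom E f)"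
    and "f \<in> Arr E \<Longrightarrow> Cod E (amap F f) = omap F (Cod E f)"
proof -
  show "omap F X \<in> Obj E" if "X \<in> Obj E" for X using assms that by (simp add: is_functor_def)
  assume "f \<in> Arr E"
  then have "amap F f \<in> hom E (omap F (Dom E f)) (omap F (Cod E f))"
    using assms unfolding is_functor_def by (blast intro: homI)
  then show "amap F f \<in> Arr E" "Dom E (amap F f) = omap F (Dom E f)"
    "Cod E (amap F f) = omap F (Cod E f)" by (auto dest: homD)
qed

lemma functor_Comp:
  assumes "is_functor E E F" "f \<in> Arr E" "g \<in> Arr E" "Dom E g = Cod E f"
  shows "amap F g \<cdot> amap F f = amap F (g \<cdot> f)"
  using assms(1) homI[OF assms(2) refl refl] homI[OF assms(3,4) refl]
  unfolding is_functor_def by fastforce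

lemma nat_trans_arrow:
  assumes "nat_trans E E F G t" "X \<in> Obj E"
  shows "t X \<in> Arr E" "Dom E (t X) = omap F X" "Cod E (t X) = omap G X"
proof -
  have "t X \<in> hom E (omap F X) (omap G X)" using assms by (simp add: nat_trans_def)
  from homD[OF this] show "t X \<in> Arr E" "Dom E (t X) = omap F X" "Cod E (t X) = omap G X" by auto
qed

lemma nat_trans_square:
  assumes "nat_trans E E F G t" "f \<in> Arr E"
  shows "amap G f \<cdot> t (Dom E f) = t (Cod E f) \<cdot> amap F f"
  using assms(1) homI[OF assms(2) refl refl] unfolding nat_trans_def by blast

lemma nat_transI:
  assumes "\<And>X. X \<in> Obj E \<Longrightarrow> t X \<in> hom E (omap F X) (omap G X)"
    and "\<And>f. f \<in> Arr E \<Longrightarrow> amap G f \<cdot> t (Dom E f) = t (Cod E f) \<cdot> amap F f"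
  shows "nat_trans E E F G t"
  using assms unfolding nat_trans_def by (auto simp: hom_def)

lemma nat_trans_Id:
  assumes "is_functor E E F"
  shows "nat_trans E E F F (\<lambda>X. Id E (omap F X))"
  by (rule nat_transI) (simp_all add: functor_arrow[OF assms] Id_in_hom)

lemma nat_trans_Comp:
  assumes F: "is_functor E E F" and G: "is_functor E E G" and H: "is_functor E E H"
    and s: "nat_trans E E F G s" and t: "nat_trans E E G H t"
  shows "nat_trans E E F H (\<lambda>X. t X \<cdot> s X)"
proof (rule nat_transI)
  note [simp] = functor_arrow[OF F] functor_arrow[OF G] functor_arrow[OF H]
    nat_trans_arrow[OF s] nat_trans_arrow[OF t]
  show "t X \<cdot> s X \<in> hom E (omap F X) (omap H X)" if "X \<in> Obj E" for X
    using that by (simp add: homI)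
  fix f assume [simp]: "f \<in> Arr E"
  have "amap H f \<cdot> (t (Dom E f) \<cdot> s (Dom E f)) = (amap H f \<cdot> t (Dom E f)) \<cdot> s (Dom E f)" by simp
  also have "\<dots> = t (Cod E f) \<cdot> (amap G f \<cdot> s (Dom E f))"
    unfolding nat_trans_square[OF t \<open>f \<in> Arr E\<close>] by simp
  also have "\<dots> = (t (Cod E f) \<cdot> s (Cod E f)) \<cdot> amap F f"
    unfolding nat_trans_square[OF s \<open>f \<in> Arr E\<close>] by simp
  finally show "amap H f \<cdot> (t (Dom E f) \<cdot> s (Dom E f)) = (t (Cod E f) \<cdot> s (Cod E f)) \<cdot> amap F f" .
qed

lemma nat_trans_inv:
  assumes F: "is_functor E E F" and G: "is_functor E E G" and t: "nat_trans E E F G t"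
    and iso: "\<And>X. X \<in> Obj E \<Longrightarrow> iso E (t X)"
  shows "nat_trans E E G F (\<lambda>X. inv_arrow E (t X))"
proof (rule nat_transI)
  note [simp] = functor_arrow[OF F] functor_arrow[OF G] nat_trans_arrow[OF t] iso
  show "inv_arrow E (t X) \<in> hom E (omap G X) (omap F X)" if "X \<in> Obj E" for X
    using that by (simp add: homI)
  fix f assume [simp]: "f \<in> Arr E"
  show "amap F f \<cdot> inv_arrow E (t (Dom E f)) = inv_arrow E (t (Cod E f)) \<cdot> amap G f"
    by (rule inverse_square) (simp_all add: nat_trans_square[OF t])
qed

lemma is_functor_cong:
  assumes "eq_functor E F G" "is_functor E E F"
  shows "is_functor E E G"
proof -
  have o: "omap G X = omap F X" if "X \<in> Obj E" for X using assms(1) that by (simp add: eq_functor_def)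
  have a: "amap G f = amap F f" if "f \<in> Arr E" for f using assms(1) that by (simp add: eq_functor_def)
  note F = functor_arrow[OF assms(2)]
  show ?thesis unfolding is_functor_def
  proof (intro conjI ballI allI)
    show "omap G X \<in> Obj E" if "X \<in> Obj E" for X using that by (simp add: o F)
    show "amap G (Id E X) = Id E (omap G X)" if "X \<in> Obj E" for X
      using assms(2) that by (simp add: o a is_functor_def)
    show "amap G f \<in> hom E (omap G X) (omap G Y)" if "f \<in> hom E X Y" for f X Y
      using homD[OF that] by (simp add: o a F homI)
    show "amap G (g \<cdot> f) = amap G g \<cdot> amap G f" if "f \<in> hom E X Y" "g \<in> hom E Y Z" for f g X Y Z
      using homD[OF that(1)] homD[OF that(2)] by (simp add: a functor_Comp[OF assms(2)])
  qed
qed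

lemma nat_trans_cong:
  assumes "nat_trans E E F G t"
    and "\<And>X. X \<in> Obj E \<Longrightarrow> omap F X = omap F' X \<and> omap G X = omap G' X \<and> t X = t' X"
    and "\<And>f. f \<in> Arr E \<Longrightarrow> amap F f = amap F' f \<and> amap G f = amap G' f"
  shows "nat_trans E E F' G' t'"
  using nat_trans_square[OF assms(1)] assms unfolding nat_trans_def by (auto simp: hom_def)

lemma localization_cong:
  assumes "eq_functor E L L'" "localization E (L, l)"
  shows "localization E (L', l)"
proof -
  have L: "is_functor E E L" and l: "nat_trans E E id_fun L l"
    and idem: "\<And>X. X \<in> Obj E \<Longrightarrow> l (omap L X) = amap L (l X) \<and> iso E (l (omap L X))"
    using assms(2) by (auto simp: localization_def)
  have "nat_trans E E id_fun L' l"
    by (rule nat_trans_cong[OF l]) (use assms(1) in \<open>auto simp: eq_functor_def\<close>)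
  moreover have "l (omap L' X) = amap L' (l X) \<and> iso E (l (omap L' X))" if "X \<in> Obj E" for X
    using idem[OF that] assms(1) that nat_trans_arrow(1)[OF l that] unfolding eq_functor_def by metis
  ultimately show ?thesis
    using is_functor_cong[OF assms(1) L] unfolding localization_def prod.case by blast
qed

lemma colocalization_cong:
  assumes "eq_functor E C C'" "colocalization E (C, c)"
  shows "colocalization E (C', c)"
proof -
  have C: "is_functor E E C" and c: "nat_trans E E C id_fun c"
    and idem: "\<And>X. X \<in> Obj E \<Longrightarrow> c (omap C X) = amap C (c X) \<and> iso E (c (omap C X))"
    using assms(2) by (auto simp: colocalization_def)
  have "nat_trans E E C' id_fun c"
    by (rule nat_trans_cong[OF c]) (use assms(1) in \<open>auto simp: eq_functor_def\<close>)
  moreover have "c (omap C' X) = amap C' (c X) \<and> iso E (c (omap C' X))" if "X \<in> Obj E" for X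
    using idem[OF that] assms(1) that nat_trans_arrow(1)[OF c that] unfolding eq_functor_def by metis
  ultimately show ?thesis
    using is_functor_cong[OF assms(1) C] unfolding colocalization_def prod.case by blast
qed

text \<open>
  Two coaugmentations that make the same functor a localization may differ (for instance, by
  automorphisms of the identity functor), but the composite
  \<open>LX \<rightarrow> LLX \<rightarrow> LX\<close> of \<open>L l'\<^sub>X\<close> and the inverse of \<open>l\<^sub>L\<^sub>X\<close> is a natural isomorphism between them.
  This is why a smashing localization is determined by its object although
  its coaugmentation is an arbitrary natural transformation.
\<close>
lemma localization_unique_for_functor:
  assumes "localization E (L, l)" "localization E (L, l')"
  shows "((L, l), (L, l')) \<in> localization_iso_rel E"
proof -
  have L: "is_functor E E L" and l: "nat_trans E E id_fun L l" and l': "nat_trans E E id_fun L l'"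
    and iso [simp]: "\<And>X. X \<in> Obj E \<Longrightarrow> iso E (l (omap L X))"
      "\<And>X. X \<in> Obj E \<Longrightarrow> iso E (amap L (l' X))"
    using assms by (auto simp: localization_def)
  note [simp] = functor_arrow[OF L] nat_trans_arrow[OF l] nat_trans_arrow[OF l']
  have [simp]: "omap id_fun X = X" "amap id_fun f = f" for X :: 'a and f :: 'b by (simp_all add: id_fun_def)
  let ?t = "\<lambda>X. inv_arrow E (l (omap L X)) \<cdot> amap L (l' X)"
  have "nat_trans E E L L ?t"
  proof (rule nat_transI)
    show "?t X \<in> hom E (omap L X) (omap L X)" if "X \<in> Obj E" for X using that by (simp add: homI)
    fix f assume f [simp]: "f \<in> Arr E"
    have 1: "amap L f \<cdot> inv_arrow E (l (omap L (Dom E f))) =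
        inv_arrow E (l (omap L (Cod E f))) \<cdot> amap L (amap L f)"
      by (rule inverse_square) (use nat_trans_square[OF l, of "amap L f"] in simp_all)
    have 2: "amap L (amap L f) \<cdot> amap L (l' (Dom E f)) = amap L (l' (Cod E f)) \<cdot> amap L f"
      using nat_trans_square[OF l' f] by (simp add: functor_Comp[OF L])
    have "amap L f \<cdot> ?t (Dom E f) =
        (amap L f \<cdot> inv_arrow E (l (omap L (Dom E f)))) \<cdot> amap L (l' (Dom E f))" by simp
    also have "\<dots> = inv_arrow E (l (omap L (Cod E f))) \<cdot> (amap L (amap L f) \<cdot> amap L (l' (Dom E f)))"
      unfolding 1 by simp
    also have "\<dots> = ?t (Cod E f) \<cdot> amap L f" unfolding 2 by simp
    finally show "amap L f \<cdot> ?t (Dom E f) = ?t (Cod E f) \<cdot> amap L f" .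
  qed
  moreover have "iso E (?t X)" if "X \<in> Obj E" for X
    using that by (intro iso_Comp) (simp_all add: iso_inv_arrow)
  moreover have "?t X \<cdot> l X = l' X" if "X \<in> Obj E" for X
    using that nat_trans_square[OF l, of "l' X"] by simp
  ultimately show ?thesis
    using assms by (auto simp: localization_iso_rel_def intro!: exI[of _ ?t])
qed

text \<open>
  Dual to \<open>localization_unique_for_functor\<close>, with the composite \<open>CX \<rightarrow> CCX \<rightarrow> CX\<close>.
\<close>
lemma colocalization_unique_for_functor:
  assumes "colocalization E (C, c)" "colocalization E (C, c')"
  shows "((C, c), (C, c')) \<in> colocalization_iso_rel E"
proof -
  have C: "is_functor E E C" and c: "nat_trans E E C id_fun c" and c': "nat_trans E E C id_fun c'"
    and iso [simp]: "\<And>X. X \<in> Obj E \<Longrightarrow> iso E (amap C (c X))"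
      "\<And>X. X \<in> Obj E \<Longrightarrow> iso E (c' (omap C X))"
    using assms by (auto simp: colocalization_def)
  note [simp] = functor_arrow[OF C] nat_trans_arrow[OF c] nat_trans_arrow[OF c']
  have [simp]: "omap id_fun X = X" "amap id_fun f = f" for X :: 'a and f :: 'b by (simp_all add: id_fun_def)
  let ?t = "\<lambda>X. amap C (c X) \<cdot> inv_arrow E (c' (omap C X))"
  have "nat_trans E E C C ?t"
  proof (rule nat_transI)
    show "?t X \<in> hom E (omap C X) (omap C X)" if "X \<in> Obj E" for X using that by (simp add: homI)
    fix f assume f [simp]: "f \<in> Arr E"
    have 1: "amap C (amap C f) \<cdot> inv_arrow E (c' (omap C (Dom E f))) =
        inv_arrow E (c' (omap C (Cod E f))) \<cdot> amap C f"
      by (rule inverse_square) (use nat_trans_square[OF c', of "amap C f"] in simp_all)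
    have 2: "amap C f \<cdot> amap C (c (Dom E f)) = amap C (c (Cod E f)) \<cdot> amap C (amap C f)"
      using nat_trans_square[OF c f] by (simp add: functor_Comp[OF C])
    have "amap C f \<cdot> ?t (Dom E f) =
        (amap C f \<cdot> amap C (c (Dom E f))) \<cdot> inv_arrow E (c' (omap C (Dom E f)))" by simp
    also have "\<dots> = amap C (c (Cod E f)) \<cdot> (amap C (amap C f) \<cdot> inv_arrow E (c' (omap C (Dom E f))))"
      unfolding 2 by simp
    also have "\<dots> = ?t (Cod E f) \<cdot> amap C f" unfolding 1 by simp
    finally show "amap C f \<cdot> ?t (Dom E f) = ?t (Cod E f) \<cdot> amap C f" .
  qed
  moreover have "iso E (?t X)" if "X \<in> Obj E" for X
    using that by (intro iso_Comp) (simp_all add: iso_inv_arrow)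
  moreover have "c' X \<cdot> ?t X = c X" if X [simp]: "X \<in> Obj E" for X
  proof -
    have "c' X \<cdot> ?t X = (c' X \<cdot> amap C (c X)) \<cdot> inv_arrow E (c' (omap C X))" by simp
    also have "\<dots> = (c X \<cdot> c' (omap C X)) \<cdot> inv_arrow E (c' (omap C X))"
      using nat_trans_square[OF c', of "c X"] by simp
    also have "\<dots> = c X" by simp
    finally show ?thesis .
  qed
  ultimately show ?thesis
    using assms by (auto simp: colocalization_iso_rel_def intro!: exI[of _ ?t])
qed

text \<open>
  With \<open>L' = L\<close> this is reflexivity; in general it passes from a functor to one that
  takes the same values on the category.
\<close>
lemma localization_iso_rel_cong:
  assumes "eq_functor E L L'" "localization E (L, l)"
  shows "((L', l), (L, l)) \<in> localization_iso_rel E"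
proof -
  note loc' = localization_cong[OF assms]
  have L: "is_functor E E L" and l: "nat_trans E E id_fun L l"
    using assms(2) by (auto simp: localization_def)
  have "nat_trans E E L' L (\<lambda>X. Id E (omap L X))"
    by (rule nat_trans_cong[OF nat_trans_Id[OF L]]) (use assms(1) in \<open>auto simp: eq_functor_def\<close>)
  moreover have "iso E (Id E (omap L X)) \<and> Id E (omap L X) \<cdot> l X = l X" if "X \<in> Obj E" for X
    using that by (simp add: nat_trans_arrow[OF l] functor_arrow[OF L] iso_Id)
  ultimately show ?thesis
    using assms(2) loc' by (auto simp: localization_iso_rel_def)
qed

lemma colocalization_iso_rel_cong:
  assumes "eq_functor E C C'" "colocalization E (C, c)"
  shows "((C', c), (C, c)) \<in> colocalization_iso_rel E"
proof -
  note loc' = colocalization_cong[OF assms]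
  have C: "is_functor E E C" and c: "nat_trans E E C id_fun c"
    using assms(2) by (auto simp: colocalization_def)
  have "nat_trans E E C' C (\<lambda>X. Id E (omap C X))"
    by (rule nat_trans_cong[OF nat_trans_Id[OF C]]) (use assms(1) in \<open>auto simp: eq_functor_def\<close>)
  moreover have "iso E (Id E (omap C X)) \<and> c X \<cdot> Id E (omap C X) = c X" if "X \<in> Obj E" for X
    using that by (simp add: nat_trans_arrow[OF c] functor_arrow[OF C] iso_Id)
  ultimately show ?thesis
    using assms(2) loc' by (auto simp: colocalization_iso_rel_def)
qed

lemma equiv_localization_iso:
  assumes "\<And>p. p \<in> S \<Longrightarrow> localization E p"
  shows "equiv S (Restr (localization_iso_rel E) S)"
proof (rule equivI)
  show "Restr (localization_iso_rel E) S \<subseteq> S \<times> S" by auto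
  show "refl_on S (Restr (localization_iso_rel E) S)"
  proof (rule refl_onI)
    fix p assume "p \<in> S"
    moreover obtain L l where "p = (L, l)" by (cases p)
    moreover have "eq_functor E L L" by (simp add: eq_functor_def)
    ultimately show "(p, p) \<in> Restr (localization_iso_rel E) S"
      using localization_iso_rel_cong assms by auto
  qed
  show "sym (Restr (localization_iso_rel E) S)"
  proof (rule symI)
    fix p q assume pq: "(p, q) \<in> Restr (localization_iso_rel E) S"
    obtain L l L' l' where p: "p = (L, l)" and q: "q = (L', l')" by (metis surj_pair)
    from pq obtain t where loc: "localization E (L, l)" "localization E (L', l')"
      and t: "nat_trans E E L L' t" and iso: "\<And>X. X \<in> Obj E \<Longrightarrow> iso E (t X)"
      and eq: "\<And>X. X \<in> Obj E \<Longrightarrow> t X \<cdot> l X = l' X"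
      by (auto simp: p q localization_iso_rel_def)
    have L: "is_functor E E L" "is_functor E E L'" and l: "nat_trans E E id_fun L l"
      using loc by (auto simp: localization_def)
    have "inv_arrow E (t X) \<cdot> l' X = l X" if X: "X \<in> Obj E" for X
      using iso[OF X] X nat_trans_arrow[OF l X] nat_trans_arrow[OF t X] by (simp add: eq[OF X, symmetric])
    then show "(q, p) \<in> Restr (localization_iso_rel E) S"
      using pq loc nat_trans_inv[OF L t iso] iso_inv_arrow[OF iso]
      by (auto simp: p q localization_iso_rel_def)
  qed
  show "trans (Restr (localization_iso_rel E) S)"
  proof (rule transI)
    fix p q r
    assume pq: "(p, q) \<in> Restr (localization_iso_rel E) S" and qr: "(q, r) \<in> Restr (localization_iso_rel E) S"
    obtain L l L' l' L'' l'' where p: "p = (L, l)" and q: "q = (L', l')" and r: "r = (L'', l'')"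
      by (metis surj_pair)
    from pq obtain s where loc: "localization E (L, l)" "localization E (L', l')"
      and s: "nat_trans E E L L' s" "\<And>X. X \<in> Obj E \<Longrightarrow> iso E (s X)"
        "\<And>X. X \<in> Obj E \<Longrightarrow> s X \<cdot> l X = l' X"
      by (auto simp: p q localization_iso_rel_def)
    from qr obtain t where loc': "localization E (L'', l'')"
      and t: "nat_trans E E L' L'' t" "\<And>X. X \<in> Obj E \<Longrightarrow> iso E (t X)"
        "\<And>X. X \<in> Obj E \<Longrightarrow> t X \<cdot> l' X = l'' X"
      by (auto simp: q r localization_iso_rel_def)
    have L: "is_functor E E L" "is_functor E E L'" "is_functor E E L''" and l: "nat_trans E E id_fun L l"
      using loc loc' by (auto simp: localization_def)
    have "iso E (t X \<cdot> s X) \<and> (t X \<cdot> s X) \<cdot> l X = l'' X" if X: "X \<in> Obj E" for X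
      using X s(2)[OF X] t(2)[OF X] nat_trans_arrow[OF l X] nat_trans_arrow[OF s(1) X]
        nat_trans_arrow[OF t(1) X]
      by (simp add: iso_Comp s(3) t(3))
    then show "(p, r) \<in> Restr (localization_iso_rel E) S"
      using pq qr loc loc' nat_trans_Comp[OF L s(1) t(1)]
      by (auto simp: p r localization_iso_rel_def)
  qed
qed

lemma equiv_colocalization_iso:
  assumes "\<And>p. p \<in> S \<Longrightarrow> colocalization E p"
  shows "equiv S (Restr (colocalization_iso_rel E) S)"
proof (rule equivI)
  show "Restr (colocalization_iso_rel E) S \<subseteq> S \<times> S" by auto
  show "refl_on S (Restr (colocalization_iso_rel E) S)"
  proof (rule refl_onI)
    fix p assume "p \<in> S"
    moreover obtain C c where "p = (C, c)" by (cases p)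
    moreover have "eq_functor E C C" by (simp add: eq_functor_def)
    ultimately show "(p, p) \<in> Restr (colocalization_iso_rel E) S"
      using colocalization_iso_rel_cong assms by auto
  qed
  show "sym (Restr (colocalization_iso_rel E) S)"
  proof (rule symI)
    fix p q assume pq: "(p, q) \<in> Restr (colocalization_iso_rel E) S"
    obtain C c C' c' where p: "p = (C, c)" and q: "q = (C', c')" by (metis surj_pair)
    from pq obtain t where loc: "colocalization E (C, c)" "colocalization E (C', c')"
      and t: "nat_trans E E C C' t" and iso: "\<And>X. X \<in> Obj E \<Longrightarrow> iso E (t X)"
      and eq: "\<And>X. X \<in> Obj E \<Longrightarrow> c' X \<cdot> t X = c X"
      by (auto simp: p q colocalization_iso_rel_def)
    have C: "is_functor E E C" "is_functor E E C'" and c': "nat_trans E E C' id_fun c'"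
      using loc by (auto simp: colocalization_def)
    have "c X \<cdot> inv_arrow E (t X) = c' X" if X: "X \<in> Obj E" for X
      using iso[OF X] X nat_trans_arrow[OF c' X] nat_trans_arrow[OF t X] by (simp add: eq[OF X, symmetric])
    then show "(q, p) \<in> Restr (colocalization_iso_rel E) S"
      using pq loc nat_trans_inv[OF C t iso] iso_inv_arrow[OF iso]
      by (auto simp: p q colocalization_iso_rel_def)
  qed
  show "trans (Restr (colocalization_iso_rel E) S)"
  proof (rule transI)
    fix p q r
    assume pq: "(p, q) \<in> Restr (colocalization_iso_rel E) S"
      and qr: "(q, r) \<in> Restr (colocalization_iso_rel E) S"
    obtain C c C' c' C'' c'' where p: "p = (C, c)" and q: "q = (C', c')" and r: "r = (C'', c'')"
      by (metis surj_pair)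
    from pq obtain s where loc: "colocalization E (C, c)" "colocalization E (C', c')"
      and s: "nat_trans E E C C' s" "\<And>X. X \<in> Obj E \<Longrightarrow> iso E (s X)"
        "\<And>X. X \<in> Obj E \<Longrightarrow> c' X \<cdot> s X = c X"
      by (auto simp: p q colocalization_iso_rel_def)
    from qr obtain t where loc': "colocalization E (C'', c'')"
      and t: "nat_trans E E C' C'' t" "\<And>X. X \<in> Obj E \<Longrightarrow> iso E (t X)"
        "\<And>X. X \<in> Obj E \<Longrightarrow> c'' X \<cdot> t X = c' X"
      by (auto simp: q r colocalization_iso_rel_def)
    have C: "is_functor E E C" "is_functor E E C'" "is_functor E E C''"
      and c'': "nat_trans E E C'' id_fun c''"
      using loc loc' by (auto simp: colocalization_def)
    have "iso E (t X \<cdot> s X) \<and> c'' X \<cdot> (t X \<cdot> s X) = c X" if X: "X \<in> Obj E" for X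
    proof
      show "iso E (t X \<cdot> s X)"
        by (rule iso_Comp) (simp_all add: X s t nat_trans_arrow[OF s(1) X] nat_trans_arrow[OF t(1) X])
      have "c'' X \<cdot> (t X \<cdot> s X) = (c'' X \<cdot> t X) \<cdot> s X"
        by (simp add: X nat_trans_arrow[OF c'' X] nat_trans_arrow[OF s(1) X] nat_trans_arrow[OF t(1) X])
      then show "c'' X \<cdot> (t X \<cdot> s X) = c X" by (simp add: X s(3) t(3))
    qed
    then show "(p, r) \<in> Restr (colocalization_iso_rel E) S"
      using pq qr loc loc' nat_trans_Comp[OF C s(1) t(1)]
      by (auto simp: p r colocalization_iso_rel_def)
  qed
qed

end

section \<open>Smashing localizations\<close>

context symmetric_monoidal_category
begin

lemma tensor_fun_simps [simp]:
  "omap (tensor_fun E A) X = X \<otimes> A" "amap (tensor_fun E A) f = f \<boxtimes> Id E A"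
  by (simp_all add: tensor_fun_def)

lemma tensor_functor:
  assumes [simp]: "A \<in> Obj E"
  shows "is_functor E E (tensor_fun E A)"
  unfolding is_functor_def
proof (intro conjI ballI allI)
  fix f g X Y Z assume f: "f \<in> hom E X Y" and g: "g \<in> hom E Y Z"
  note [simp] = homD[OF f] homD[OF g]
  show "amap (tensor_fun E A) (g \<cdot> f) = amap (tensor_fun E A) g \<cdot> amap (tensor_fun E A) f"
    by (simp add: merge)
qed (simp_all add: tensor_in_hom Id_in_hom)

lemma smashing_of_coaug: "smashing_of E R = (tensor_fun E (carr R), coaug (unit R))"
  by (simp add: smashing_of_def coaug_def[abs_def])

lemma smashing_of_localization:
  assumes "R \<in> solid_monoids E"
  shows "smashing_of E R \<in> smashing_localizations E"
proof -
  interpret idempotent_object E "carr R" "unit R" using assms by (rule solid_monoid_idempotent)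
  have "nat_trans E E id_fun (tensor_fun E (carr R)) (coaug (unit R))"
  proof (rule nat_transI)
    show "coaug (unit R) X \<in> hom E (omap id_fun X) (omap (tensor_fun E (carr R)) X)"
      if "X \<in> Obj E" for X using that by (simp add: homI id_fun_def)
    show "amap (tensor_fun E (carr R)) f \<cdot> coaug (unit R) (Dom E f) =
        coaug (unit R) (Cod E f) \<cdot> amap id_fun f"
      if "f \<in> Arr E" for f using coaug_nat[of "unit R" f] that by (simp add: id_fun_def)
  qed
  then have "localization E (smashing_of E R)"
    using coaug_tensor iso_coaug_tensor
    by (simp add: localization_def smashing_of_coaug tensor_functor)
  then show ?thesis
    by (auto simp: smashing_localizations_def smashing_of_coaug eq_functor_def intro!: bexI[of _ "carr R"])
qed

text \<open>
  The component at \<open>\<I>\<close> of an isomorphism of functors is, up to unit constraints, an isomorphism of the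
  objects that preserves the units; conversely an isomorphism of monoids is tensored with
  every object.
\<close>
lemma smashing_of_iso_iff:
  assumes R: "R \<in> solid_monoids E" and S: "S \<in> solid_monoids E"
  shows "(smashing_of E R, smashing_of E S) \<in> smashing_iso E \<longleftrightarrow> (R, S) \<in> solid_iso E"
proof -
  interpret R: idempotent_object E "carr R" "unit R" using R by (rule solid_monoid_idempotent)
  interpret S: idempotent_object E "carr S" "unit S" using S by (rule solid_monoid_idempotent)
  have loc: "localization E (tensor_fun E (carr R), coaug (unit R))"
    "localization E (tensor_fun E (carr S), coaug (unit S))"
    using smashing_of_localization[OF R] smashing_of_localization[OF S]
    by (auto simp: smashing_of_coaug smashing_localizations_def)
  show ?thesis
  proof
    assume "(smashing_of E R, smashing_of E S) \<in> smashing_iso E"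
    then obtain t where t: "nat_trans E E (tensor_fun E (carr R)) (tensor_fun E (carr S)) t"
      and iso: "\<And>X. X \<in> Obj E \<Longrightarrow> iso E (t X)"
      and eq: "\<And>X. X \<in> Obj E \<Longrightarrow> t X \<cdot> coaug (unit R) X = coaug (unit S) X"
      by (auto simp: smashing_iso_def localization_iso_rel_def smashing_of_coaug)
    note [simp] = nat_trans_arrow[OF t, of \<I>] iso[of \<I>]
    let ?f = "lunit E (carr S) \<cdot> (t \<I> \<cdot> inv_arrow E (lunit E (carr R)))"
    have "?f \<cdot> unit R = ?f \<cdot> (lunit E (carr R) \<cdot> coaug (unit R) \<I>)"
      using lunit_coaug_unit[of "unit R"] by simp
    also have "\<dots> = lunit E (carr S) \<cdot> (t \<I> \<cdot> coaug (unit R) \<I>)" by simp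
    also have "\<dots> = unit S"
      using lunit_coaug_unit[of "unit S"] by (simp add: eq)
    finally show "(R, S) \<in> solid_iso E"
      by (intro solid_isoI[OF R S, of ?f]) (simp_all add: homI iso_Comp iso_inv_arrow)
  next
    assume "(R, S) \<in> solid_iso E"
    then obtain f where f: "f \<in> hom E (carr R) (carr S)" "iso E f" and eq: "f \<cdot> unit R = unit S"
      by (rule solid_isoE)
    note [simp] = homD[OF f(1)]
    have "nat_trans E E (tensor_fun E (carr R)) (tensor_fun E (carr S)) (\<lambda>X. Id E X \<boxtimes> f)"
      by (rule nat_transI) (simp_all add: homI merge)
    moreover have "iso E (Id E X \<boxtimes> f) \<and> (Id E X \<boxtimes> f) \<cdot> coaug (unit R) X = coaug (unit S) X"
      if "X \<in> Obj E" for X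
      using coaug_comp[of "unit R" f X] that by (simp add: f eq)
    ultimately have "(smashing_of E R, smashing_of E S) \<in> localization_iso_rel E"
      using loc by (auto simp: localization_iso_rel_def smashing_of_coaug intro!: exI[of _ "\<lambda>X. Id E X \<boxtimes> f"])
    then show "(smashing_of E R, smashing_of E S) \<in> smashing_iso E"
      using smashing_of_localization[OF R] smashing_of_localization[OF S] by (simp add: smashing_iso_def)
  qed
qed

lemma equiv_smashing_iso: "equiv (smashing_localizations E) (smashing_iso E)"
  unfolding smashing_iso_def
  by (rule equiv_localization_iso) (auto simp: smashing_localizations_def)

text \<open>
  \<open>L l\<^sub>\<I>\<close> is \<open>l\<^sub>\<I> \<boxtimes> Id E A\<close>, and it is invertible because it equals the coaugmentation at \<open>L \<I>\<close>.
\<close>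
lemma smashing_localization_idempotent:
  assumes A [simp]: "A \<in> Obj E" and loc: "localization E (tensor_fun E A, l)"
  shows "idempotent_object E A (lunit E A \<cdot> l \<I>)"
proof
  have l: "nat_trans E E id_fun (tensor_fun E A) l"
    and idem: "\<forall>X \<in> Obj E. l (X \<otimes> A) = l X \<boxtimes> Id E A \<and> iso E (l (X \<otimes> A))"
    using loc unfolding localization_def prod.case tensor_fun_simps by blast+
  from bspec[OF idem unit_in_Obj] have iso: "iso E (l \<I> \<boxtimes> Id E A)" by metis
  note [simp] = nat_trans_arrow[OF l, of \<I>]
  have [simp]: "omap id_fun X = X" for X :: 'a by (simp add: id_fun_def)
  show "lunit E A \<cdot> l \<I> \<in> hom E \<I> A" by (simp add: homI)
  have "iso E ((lunit E A \<boxtimes> Id E A) \<cdot> (l \<I> \<boxtimes> Id E A))"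
    by (rule iso_Comp) (simp_all add: iso)
  then show "iso E ((lunit E A \<cdot> l \<I>) \<boxtimes> Id E A)" by (simp add: merge)
qed

lemma smashing_localization_is_smashing_of:
  assumes "p \<in> smashing_localizations E"
  shows "\<exists>R \<in> solid_monoids E. (smashing_of E R, p) \<in> smashing_iso E"
proof -
  obtain L l A where p: "p = (L, l)" and loc: "localization E (L, l)"
    and A: "A \<in> Obj E" and eq: "eq_functor E L (tensor_fun E A)"
    using assms by (auto simp: smashing_localizations_def)
  have loc': "localization E (tensor_fun E A, l)" by (rule localization_cong[OF eq loc])
  interpret idempotent_object E A "lunit E A \<cdot> l \<I>"
    by (rule smashing_localization_idempotent[OF A loc'])
  have mem: "smashing_of E solid_monoid \<in> smashing_localizations E"
    by (rule smashing_of_localization[OF solid_monoid_solid])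
  then have loc'': "localization E (smashing_of E solid_monoid)"
    by (auto simp: smashing_localizations_def)
  have p': "(tensor_fun E A, l) \<in> smashing_localizations E"
    using loc' A by (auto simp: smashing_localizations_def eq_functor_def)
  have "(smashing_of E solid_monoid, (tensor_fun E A, l)) \<in> smashing_iso E"
    using localization_unique_for_functor[OF _ loc', of "coaug (lunit E A \<cdot> l \<I>)"] loc'' mem p'
    by (simp add: smashing_iso_def smashing_of_coaug)
  moreover have "((tensor_fun E A, l), p) \<in> smashing_iso E"
    using localization_iso_rel_cong[OF eq loc] assms p' by (simp add: smashing_iso_def p)
  ultimately have "(smashing_of E solid_monoid, p) \<in> smashing_iso E"
    using equiv_smashing_iso by (meson equiv_def transE)
  then show ?thesis using solid_monoid_solid by blast
qed

end

section \<open>Mapping colocalizations\<close>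

context closed_symmetric_monoidal_category
begin

lemma ihom_arrows [simp]:
  assumes "A \<in> Obj E" "X \<in> Obj E"
  shows "ihom E A X \<in> Obj E" "ev E A X \<in> Arr E" "Dom E (ev E A X) = ihom E A X \<otimes> A" "Cod E (ev E A X) = X"
  using homD[OF ev_in_hom[OF assms]] ihom_in_Obj[OF assms] by simp_all

lemma curry_arrow [simp]:
  assumes "A \<in> Obj E" "Z \<in> Obj E" "f \<in> Arr E" "Dom E f = Z \<otimes> A" "Cod E f = X"
  shows "curry_arrow E Z A X f \<in> Arr E" "Dom E (curry_arrow E Z A X f) = Z"
    "Cod E (curry_arrow E Z A X f) = ihom E A X"
    "ev E A X \<cdot> (curry_arrow E Z A X f \<boxtimes> Id E A) = f"
proof -
  have "X \<in> Obj E" using assms by auto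
  from theI'[OF ev_universal[OF assms(1) this assms(2) homI[OF assms(3-5)]]]
  have *: "curry_arrow E Z A X f \<in> hom E Z (ihom E A X)" "ev E A X \<cdot> (curry_arrow E Z A X f \<boxtimes> Id E A) = f"
    unfolding curry_arrow_def by blast+
  from homD[OF *(1)] *(2)
  show "curry_arrow E Z A X f \<in> Arr E" "Dom E (curry_arrow E Z A X f) = Z"
    "Cod E (curry_arrow E Z A X f) = ihom E A X"
    "ev E A X \<cdot> (curry_arrow E Z A X f \<boxtimes> Id E A) = f" by auto
qed

lemma ev_cancel:
  assumes "A \<in> Obj E" "X \<in> Obj E" "g \<in> hom E Z (ihom E A X)" "h \<in> hom E Z (ihom E A X)"
    and eq: "ev E A X \<cdot> (g \<boxtimes> Id E A) = ev E A X \<cdot> (h \<boxtimes> Id E A)"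
  shows "g = h"
proof -
  note [simp] = homD[OF assms(3)] assms(1,2)
  have "ev E A X \<cdot> (g \<boxtimes> Id E A) \<in> hom E (Z \<otimes> A) X" by (simp add: homI)
  from ev_universal[OF assms(1,2) _ this] assms show ?thesis by auto
qed

lemma ihom_fun_omap [simp]: "omap (ihom_fun E A) X = ihom E A X"
  by (simp add: ihom_fun_def)

lemma ihom_fun_amap [simp]:
  assumes "A \<in> Obj E" "f \<in> Arr E"
  shows "amap (ihom_fun E A) f \<in> Arr E" "Dom E (amap (ihom_fun E A) f) = ihom E A (Dom E f)"
    "Cod E (amap (ihom_fun E A) f) = ihom E A (Cod E f)"
  using assms by (simp_all add: ihom_fun_def)

lemma ev_ihom_fun:
  assumes "A \<in> Obj E" "f \<in> Arr E"
  shows "ev E A (Cod E f) \<cdot> (amap (ihom_fun E A) f \<boxtimes> Id E A) = f \<cdot> ev E A (Dom E f)"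
  using assms by (simp add: ihom_fun_def)

lemma ev_ihom_fun_comp:
  assumes [simp]: "A \<in> Obj E" "f \<in> Arr E" "g \<in> Arr E" "Cod E g = ihom E A (Dom E f)"
  shows "ev E A (Cod E f) \<cdot> ((amap (ihom_fun E A) f \<cdot> g) \<boxtimes> Id E A) =
    f \<cdot> (ev E A (Dom E f) \<cdot> (g \<boxtimes> Id E A))"
proof -
  have "ev E A (Cod E f) \<cdot> ((amap (ihom_fun E A) f \<cdot> g) \<boxtimes> Id E A) =
      (ev E A (Cod E f) \<cdot> (amap (ihom_fun E A) f \<boxtimes> Id E A)) \<cdot> (g \<boxtimes> Id E A)"
    by (simp add: merge)
  then show ?thesis by (simp only: ev_ihom_fun assms) simp
qed

lemma ihom_functor:
  assumes [simp]: "A \<in> Obj E"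
  shows "is_functor E E (ihom_fun E A)"
  unfolding is_functor_def
proof (intro conjI ballI allI)
  show "omap (ihom_fun E A) X \<in> Obj E" if "X \<in> Obj E" for X using that by simp
  show "amap (ihom_fun E A) f \<in> hom E (omap (ihom_fun E A) X) (omap (ihom_fun E A) Y)"
    if "f \<in> hom E X Y" for f X Y using homD[OF that] by (simp add: homI)
  show "amap (ihom_fun E A) (Id E X) = Id E (omap (ihom_fun E A) X)" if [simp]: "X \<in> Obj E" for X
    by (rule ev_cancel[of A X _ "ihom E A X"])
       (use ev_ihom_fun[of A "Id E X"] in \<open>simp_all add: homI\<close>)
  fix f g X Y Z assume f: "f \<in> hom E X Y" and g: "g \<in> hom E Y Z"
  note [simp] = homD[OF f] homD[OF g]
  show "amap (ihom_fun E A) (g \<cdot> f) = amap (ihom_fun E A) g \<cdot> amap (ihom_fun E A) f"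
  proof (rule ev_cancel[of A Z _ "ihom E A X"])
    show "ev E A Z \<cdot> (amap (ihom_fun E A) (g \<cdot> f) \<boxtimes> Id E A) =
        ev E A Z \<cdot> ((amap (ihom_fun E A) g \<cdot> amap (ihom_fun E A) f) \<boxtimes> Id E A)"
      using ev_ihom_fun[of A "g \<cdot> f"] ev_ihom_fun[of A f]
        ev_ihom_fun_comp[of A g "amap (ihom_fun E A) f"] by simp
  qed (simp_all add: homI)
qed

text \<open>
  Evaluation at \<open>\<eta>\<close>, bracketed as in \<open>mapping_of\<close> so that the two agree as functions on
  all arguments and not only on objects.
\<close>
definition aug :: "'a \<Rightarrow> 'b \<Rightarrow> 'a \<Rightarrow> 'b" where
  "aug A \<eta> X = ev E A X \<cdot> (Id E (ihom E A X) \<boxtimes> \<eta>) \<cdot> inv_arrow E (runit E (ihom E A X))"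

lemma mapping_of_aug: "mapping_of E R = (ihom_fun E (carr R), aug (carr R) (unit R))"
  by (simp add: mapping_of_def aug_def[abs_def])

lemma aug_coaug:
  assumes "\<eta> \<in> hom E \<I> A" "X \<in> Obj E"
  shows "aug A \<eta> X = ev E A X \<cdot> coaug \<eta> (ihom E A X)"
  using homD[OF assms(1)] assms(2) by (simp add: aug_def coaug_def)

lemma aug_arrow [simp]:
  assumes "\<eta> \<in> hom E \<I> A" "X \<in> Obj E"
  shows "aug A \<eta> X \<in> Arr E" "Dom E (aug A \<eta> X) = ihom E A X" "Cod E (aug A \<eta> X) = X"
  using homD[OF assms(1)] assms(2) by (simp_all add: aug_coaug[OF assms])

lemma aug_comp:
  assumes \<eta>: "\<eta> \<in> hom E \<I> A" and [simp]: "X \<in> Obj E" "g \<in> Arr E" "Cod E g = ihom E A X"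
  shows "aug A \<eta> X \<cdot> g = ev E A X \<cdot> ((g \<boxtimes> Id E A) \<cdot> coaug \<eta> (Dom E g))"
  using homD[OF \<eta>] coaug_nat[of \<eta> g] by (simp add: aug_coaug[OF \<eta>])

lemma aug_nat_trans:
  assumes \<eta>: "\<eta> \<in> hom E \<I> A"
  shows "nat_trans E E (ihom_fun E A) id_fun (aug A \<eta>)"
proof (rule nat_transI)
  note [simp] = homD[OF \<eta>]
  show "aug A \<eta> X \<in> hom E (omap (ihom_fun E A) X) (omap id_fun X)" if "X \<in> Obj E" for X
    using that \<eta> by (simp add: homI id_fun_def)
  fix f assume [simp]: "f \<in> Arr E"
  have "aug A \<eta> (Cod E f) \<cdot> amap (ihom_fun E A) f =
      (ev E A (Cod E f) \<cdot> (amap (ihom_fun E A) f \<boxtimes> Id E A)) \<cdot> coaug \<eta> (ihom E A (Dom E f))"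
    using \<eta> by (simp add: aug_comp)
  also have "\<dots> = f \<cdot> aug A \<eta> (Dom E f)"
    by (simp add: ev_ihom_fun aug_coaug[OF \<eta>])
  finally show "amap id_fun f \<cdot> aug A \<eta> (Dom E f) = aug A \<eta> (Cod E f) \<cdot> amap (ihom_fun E A) f"
    by (simp add: id_fun_def)
qed

end

locale closed_idempotent_object =
  closed_symmetric_monoidal_category E + idempotent_object E A \<eta>
  for E :: "('o, 'm, 'z) csm_category_scheme" (structure) and A :: 'o and \<eta> :: 'm
begin

text \<open>
  Evaluation is natural for \<open>coaug\<close>; the idempotency enters through
  \<open>coaug_tensor\<close>, which decides where \<open>\<eta>\<close> is inserted.
\<close>
lemma aug_tensor:
  assumes [simp]: "Y \<in> Obj E"
  shows "aug A \<eta> Y \<boxtimes> Id E A = coaug \<eta> Y \<cdot> ev E A Y"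
proof -
  have "aug A \<eta> Y \<boxtimes> Id E A = (ev E A Y \<boxtimes> Id E A) \<cdot> (coaug \<eta> (ihom E A Y) \<boxtimes> Id E A)"
    by (simp add: aug_coaug[OF unit_hom] merge)
  also have "\<dots> = (ev E A Y \<boxtimes> Id E A) \<cdot> coaug \<eta> (ihom E A Y \<otimes> A)"
    by (simp add: coaug_tensor)
  also have "\<dots> = coaug \<eta> Y \<cdot> ev E A Y"
    using coaug_nat[of \<eta> "ev E A Y"] by simp
  finally show ?thesis .
qed

text \<open>
  Internal homs out of \<open>A\<close> are local: the inverse \<open>m : Hom(A, X) \<otimes> A \<rightarrow> Hom(A, X)\<close> is
  the action \<open>(\<phi>, a) \<mapsto> \<phi>(a \<cdot> -)\<close>, obtained by currying evaluation precomposed with the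
  inverse of \<open>coaug \<boxtimes> Id E A\<close>. It is a two-sided inverse because \<open>coaug \<cdot> m\<close> is
  \<open>(m \<cdot> coaug) \<boxtimes> Id E A\<close> by naturality and \<open>coaug_tensor\<close>.
\<close>
lemma iso_coaug_ihom:
  assumes [simp]: "X \<in> Obj E"
  shows "iso E (coaug \<eta> (ihom E A X))"
proof -
  let ?Y = "ihom E A X"
  let ?l = "coaug \<eta> ?Y"
  have iso [simp]: "iso E (?l \<boxtimes> Id E A)"
    using iso_coaug_tensor[of ?Y] coaug_tensor[of ?Y] by simp
  define m where "m = curry_arrow E (?Y \<otimes> A) A X (ev E A X \<cdot> inv_arrow E (?l \<boxtimes> Id E A))"
  have m [simp]: "m \<in> Arr E" "Dom E m = ?Y \<otimes> A" "Cod E m = ?Y"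
    and ev: "ev E A X \<cdot> (m \<boxtimes> Id E A) = ev E A X \<cdot> inv_arrow E (?l \<boxtimes> Id E A)"
    by (simp_all add: m_def)
  have 1: "m \<cdot> ?l = Id E ?Y"
  proof (rule ev_cancel[of A X _ ?Y])
    have "ev E A X \<cdot> ((m \<cdot> ?l) \<boxtimes> Id E A) = (ev E A X \<cdot> (m \<boxtimes> Id E A)) \<cdot> (?l \<boxtimes> Id E A)"
      by (simp add: merge)
    then show "ev E A X \<cdot> ((m \<cdot> ?l) \<boxtimes> Id E A) = ev E A X \<cdot> (Id E ?Y \<boxtimes> Id E A)"
      unfolding ev by simp
  qed (simp_all add: homI)
  have "?l \<cdot> m = (m \<boxtimes> Id E A) \<cdot> coaug \<eta> (?Y \<otimes> A)"
    using coaug_nat[of \<eta> m] by simp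
  also have "\<dots> = Id E (?Y \<otimes> A)"
    by (simp add: coaug_tensor merge 1)
  finally show ?thesis
    by (intro isoI[of ?l ?Y "?Y \<otimes> A" m]) (simp_all add: homI 1)
qed

text \<open>
  If \<open>Y\<close> is local, then the inverse of \<open>coaug \<eta> Y\<close> is an action of \<open>A\<close> on \<open>Y\<close>, and its curried
  form \<open>Y \<rightarrow> Hom(A, Y)\<close> is inverse to the evaluation at the unit.
\<close>
lemma iso_aug:
  assumes [simp]: "Y \<in> Obj E" and iso [simp]: "iso E (coaug \<eta> Y)"
  shows "iso E (aug A \<eta> Y)"
proof -
  define d where "d = curry_arrow E Y A Y (inv_arrow E (coaug \<eta> Y))"
  have [simp]: "d \<in> Arr E" "Dom E d = Y" "Cod E d = ihom E A Y"
    and ev: "ev E A Y \<cdot> (d \<boxtimes> Id E A) = inv_arrow E (coaug \<eta> Y)"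
    by (simp_all add: d_def)
  note [simp] = aug_arrow[OF unit_hom]
  have "aug A \<eta> Y \<cdot> d = (ev E A Y \<cdot> (d \<boxtimes> Id E A)) \<cdot> coaug \<eta> Y"
    by (simp add: aug_comp[OF unit_hom])
  then have 1: "aug A \<eta> Y \<cdot> d = Id E Y" unfolding ev by simp
  have 2: "d \<cdot> aug A \<eta> Y = Id E (ihom E A Y)"
  proof (rule ev_cancel[of A Y _ "ihom E A Y"])
    have "ev E A Y \<cdot> ((d \<cdot> aug A \<eta> Y) \<boxtimes> Id E A) =
        (ev E A Y \<cdot> (d \<boxtimes> Id E A)) \<cdot> (aug A \<eta> Y \<boxtimes> Id E A)"
      by (simp add: merge)
    also have "\<dots> = ev E A Y" unfolding ev aug_tensor[OF assms(1)] by simp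
    finally show "ev E A Y \<cdot> ((d \<cdot> aug A \<eta> Y) \<boxtimes> Id E A) = ev E A Y \<cdot> (Id E (ihom E A Y) \<boxtimes> Id E A)"
      by simp
  qed (simp_all add: homI)
  show ?thesis
    by (rule isoI[of _ "ihom E A Y" Y d]) (simp_all add: homI 1 2)
qed

text \<open>
  For \<open>\<phi> : A \<otimes> A \<rightarrow> X\<close> the two arrows send \<open>\<phi>\<close> to \<open>\<phi>(\<eta>, -)\<close> and \<open>\<phi>(-, \<eta>)\<close>; these agree
  because the two insertions of the unit do.
\<close>
lemma aug_ihom:
  assumes [simp]: "X \<in> Obj E"
  shows "aug A \<eta> (ihom E A X) = amap (ihom_fun E A) (aug A \<eta> X)"
proof (rule ev_cancel[of A X _ "ihom E A (ihom E A X)"])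
  note [simp] = aug_arrow[OF unit_hom]
  have "ev E A X \<cdot> (aug A \<eta> (ihom E A X) \<boxtimes> Id E A) = aug A \<eta> X \<cdot> ev E A (ihom E A X)"
    by (simp add: aug_tensor aug_coaug[OF unit_hom, of X])
  also have "\<dots> = ev E A X \<cdot> (amap (ihom_fun E A) (aug A \<eta> X) \<boxtimes> Id E A)"
    using ev_ihom_fun[of A "aug A \<eta> X"] by simp
  finally show "ev E A X \<cdot> (aug A \<eta> (ihom E A X) \<boxtimes> Id E A) =
      ev E A X \<cdot> (amap (ihom_fun E A) (aug A \<eta> X) \<boxtimes> Id E A)" .
  show "aug A \<eta> (ihom E A X) \<in> hom E (ihom E A (ihom E A X)) (ihom E A X)"
    "amap (ihom_fun E A) (aug A \<eta> X) \<in> hom E (ihom E A (ihom E A X)) (ihom E A X)"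
    by (simp_all add: homI)
qed simp_all

lemma colocalization_aug: "colocalization E (ihom_fun E A, aug A \<eta>)"
  by (simp add: colocalization_def ihom_functor aug_nat_trans[OF unit_hom] aug_ihom[symmetric]
      iso_aug iso_coaug_ihom)

end

context closed_symmetric_monoidal_category
begin

lemma solid_monoid_closed_idempotent:
  assumes "R \<in> solid_monoids E"
  shows "closed_idempotent_object E (carr R) (unit R)"
proof -
  interpret idempotent_object E "carr R" "unit R" using assms by (rule solid_monoid_idempotent)
  show ?thesis ..
qed

lemma mapping_of_colocalization:
  assumes "R \<in> solid_monoids E"
  shows "mapping_of E R \<in> mapping_colocalizations E"
proof -
  interpret closed_idempotent_object E "carr R" "unit R"
    using assms by (rule solid_monoid_closed_idempotent)
  show ?thesis
    using colocalization_aug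
    by (auto simp: mapping_colocalizations_def mapping_of_aug eq_functor_def intro!: bexI[of _ "carr R"])
qed

lemma equiv_mapping_iso: "equiv (mapping_colocalizations E) (mapping_iso E)"
  unfolding mapping_iso_def
  by (rule equiv_colocalization_iso) (auto simp: mapping_colocalizations_def)

text \<open>
  The global element \<open>\<I> \<rightarrow> Hom(A, X)\<close> that corresponds to an arrow \<open>f : A \<rightarrow> X\<close>.
\<close>
definition point :: "'a \<Rightarrow> 'b \<Rightarrow> 'b" where
  "point A f = curry_arrow E \<I> A (Cod E f) (f \<cdot> lunit E A)"

lemma point_arrow [simp]:
  assumes "A \<in> Obj E" "f \<in> Arr E" "Dom E f = A"
  shows "point A f \<in> Arr E" "Dom E (point A f) = \<I>" "Cod E (point A f) = ihom E A (Cod E f)"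
    "ev E A (Cod E f) \<cdot> (point A f \<boxtimes> Id E A) = f \<cdot> lunit E A"
  using assms by (simp_all add: point_def)

lemma point_surj:
  assumes [simp]: "A \<in> Obj E" "X \<in> Obj E" and h: "h \<in> hom E \<I> (ihom E A X)"
  obtains f where "f \<in> hom E A X" "point A f = h"
proof
  note [simp] = homD[OF h]
  let ?f = "(ev E A X \<cdot> (h \<boxtimes> Id E A)) \<cdot> inv_arrow E (lunit E A)"
  show "?f \<in> hom E A X" by (simp add: homI)
  show "point A ?f = h"
    by (rule ev_cancel[of A X _ \<I>]) (use point_arrow(4)[of A ?f] in \<open>simp_all add: homI\<close>)
qed

lemma point_inj:
  assumes [simp]: "f \<in> Arr E" "g \<in> Arr E" "Dom E f = A" "Dom E g = A" "Cod E g = Cod E f"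
    and eq: "point A f = point A g"
  shows "f = g"
proof (rule iso_cancel_right[of "lunit E A"])
  have [simp]: "A \<in> Obj E" using assms(3) Obj_Dom_Cod(1)[OF assms(1)] by metis
  show "f \<cdot> lunit E A = g \<cdot> lunit E A"
    using point_arrow(4)[of A f] point_arrow(4)[of A g] eq by simp
  show "iso E (lunit E A)" "Dom E f = Cod E (lunit E A)" "Dom E g = Cod E (lunit E A)" by simp_all
qed simp_all

text \<open>
  The Yoneda lemma for an augmentation of \<open>Hom(A, -)\<close>: on global elements it is restriction
  along one arrow \<open>\<I> \<rightarrow> A\<close>, its value at the identity of \<open>A\<close>.
\<close>
lemma augmentation_point:
  assumes [simp]: "A \<in> Obj E" and c: "nat_trans E E (ihom_fun E A) id_fun c"
    and f: "f \<in> hom E A X"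
  shows "c X \<cdot> point A f = f \<cdot> (c A \<cdot> point A (Id E A))"
proof -
  note [simp] = homD[OF f] nat_trans_arrow[OF c]
  have [simp]: "omap id_fun X = X" "amap id_fun f = f" for X :: 'a and f :: 'b by (simp_all add: id_fun_def)
  have "amap (ihom_fun E A) f \<cdot> point A (Id E A) = point A f"
    by (rule ev_cancel[of A X _ \<I>])
       (use ev_ihom_fun_comp[of A f "point A (Id E A)"] point_arrow(4)[of A "Id E A"]
         point_arrow(4)[of A f] in \<open>simp_all add: homI\<close>)
  then have "c X \<cdot> point A f = (c X \<cdot> amap (ihom_fun E A) f) \<cdot> point A (Id E A)" by simp
  also have "\<dots> = (f \<cdot> c A) \<cdot> point A (Id E A)"
    using nat_trans_square[OF c, of f] by simp
  finally show ?thesis by simp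
qed

lemma aug_point_Id:
  assumes \<eta>: "\<eta> \<in> hom E \<I> A"
  shows "aug A \<eta> A \<cdot> point A (Id E A) = \<eta>"
proof -
  note [simp] = homD[OF \<eta>]
  have "aug A \<eta> A \<cdot> point A (Id E A) = (ev E A A \<cdot> (point A (Id E A) \<boxtimes> Id E A)) \<cdot> coaug \<eta> \<I>"
    by (simp add: aug_comp[OF \<eta>])
  also have "\<dots> = \<eta>"
    using point_arrow(4)[of A "Id E A"] lunit_coaug_unit[of \<eta>] by simp
  finally show ?thesis .
qed

definition precomp :: "'b \<Rightarrow> 'a \<Rightarrow> 'b" where
  "precomp g X =
     curry_arrow E (ihom E (Cod E g) X) (Dom E g) X (ev E (Cod E g) X \<cdot> (Id E (ihom E (Cod E g) X) \<boxtimes> g))"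

lemma precomp_arrow [simp]:
  assumes "g \<in> Arr E" "X \<in> Obj E"
  shows "precomp g X \<in> Arr E" "Dom E (precomp g X) = ihom E (Cod E g) X"
    "Cod E (precomp g X) = ihom E (Dom E g) X"
    "ev E (Dom E g) X \<cdot> (precomp g X \<boxtimes> Id E (Dom E g)) =
       ev E (Cod E g) X \<cdot> (Id E (ihom E (Cod E g) X) \<boxtimes> g)"
  using assms by (simp_all add: precomp_def)

lemma precomp_split:
  assumes [simp]: "g \<in> Arr E" "X \<in> Obj E" "h \<in> Arr E" "Cod E h = ihom E (Cod E g) X"
  shows "ev E (Dom E g) X \<cdot> ((precomp g X \<cdot> h) \<boxtimes> Id E (Dom E g)) = ev E (Cod E g) X \<cdot> (h \<boxtimes> g)"
proof -
  have "ev E (Dom E g) X \<cdot> ((precomp g X \<cdot> h) \<boxtimes> Id E (Dom E g)) =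
      (ev E (Dom E g) X \<cdot> (precomp g X \<boxtimes> Id E (Dom E g))) \<cdot> (h \<boxtimes> Id E (Dom E g))"
    by (simp add: merge del: precomp_arrow(4))
  also have "\<dots> = ev E (Cod E g) X \<cdot> (h \<boxtimes> g)"
    by (simp only: precomp_arrow assms) (simp add: merge)
  finally show ?thesis .
qed

lemma precomp_inverse:
  assumes f: "f \<in> hom E A B" and g: "g \<in> hom E B A" and gf: "g \<cdot> f = Id E A" and [simp]: "X \<in> Obj E"
  shows "precomp f X \<cdot> precomp g X = Id E (ihom E A X)"
proof (rule ev_cancel[of A X _ "ihom E A X"])
  note [simp] = homD[OF f] homD[OF g]
  have "ev E A X \<cdot> ((precomp f X \<cdot> precomp g X) \<boxtimes> Id E A) = ev E B X \<cdot> (precomp g X \<boxtimes> f)"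
    using precomp_split[of f X "precomp g X"] by simp
  also have "\<dots> = (ev E B X \<cdot> (precomp g X \<boxtimes> Id E B)) \<cdot> (Id E (ihom E A X) \<boxtimes> f)"
    by (simp add: merge)
  also have "\<dots> = ev E A X \<cdot> (Id E (ihom E A X) \<boxtimes> Id E A)"
    using precomp_arrow(4)[of g X] by (simp add: merge gf)
  finally show "ev E A X \<cdot> ((precomp f X \<cdot> precomp g X) \<boxtimes> Id E A) =
      ev E A X \<cdot> (Id E (ihom E A X) \<boxtimes> Id E A)" .
  show "precomp f X \<cdot> precomp g X \<in> hom E (ihom E A X) (ihom E A X)"
    "Id E (ihom E A X) \<in> hom E (ihom E A X) (ihom E A X)" "A \<in> Obj E" "X \<in> Obj E"
    by (simp_all add: homI)
qed

lemma precomp_nat_trans: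
  assumes g: "g \<in> hom E B A"
  shows "nat_trans E E (ihom_fun E A) (ihom_fun E B) (precomp g)"
proof (rule nat_transI)
  note [simp] = homD[OF g]
  show "precomp g X \<in> hom E (omap (ihom_fun E A) X) (omap (ihom_fun E B) X)" if "X \<in> Obj E" for X
    using that by (simp add: homI)
  fix k assume [simp]: "k \<in> Arr E"
  let ?X = "Dom E k" and ?Y = "Cod E k"
  show "amap (ihom_fun E B) k \<cdot> precomp g ?X = precomp g ?Y \<cdot> amap (ihom_fun E A) k"
  proof (rule ev_cancel[of B ?Y _ "ihom E A ?X"])
    have "ev E B ?Y \<cdot> ((amap (ihom_fun E B) k \<cdot> precomp g ?X) \<boxtimes> Id E B) =
        k \<cdot> (ev E A ?X \<cdot> (Id E (ihom E A ?X) \<boxtimes> g))"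
      using ev_ihom_fun_comp[of B k "precomp g ?X"] precomp_arrow(4)[of g ?X] by simp
    also have "\<dots> = (k \<cdot> ev E A ?X) \<cdot> (Id E (ihom E A ?X) \<boxtimes> g)" by simp
    also have "\<dots> = (ev E A ?Y \<cdot> (amap (ihom_fun E A) k \<boxtimes> Id E A)) \<cdot> (Id E (ihom E A ?X) \<boxtimes> g)"
      by (simp only: ev_ihom_fun homD[OF g] \<open>k \<in> Arr E\<close>)
    also have "\<dots> = ev E A ?Y \<cdot> (amap (ihom_fun E A) k \<boxtimes> g)" by (simp add: merge)
    also have "\<dots> = ev E B ?Y \<cdot> ((precomp g ?Y \<cdot> amap (ihom_fun E A) k) \<boxtimes> Id E B)"
      using precomp_split[of g ?Y "amap (ihom_fun E A) k"] by simp
    finally show "ev E B ?Y \<cdot> ((amap (ihom_fun E B) k \<cdot> precomp g ?X) \<boxtimes> Id E B) =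
        ev E B ?Y \<cdot> ((precomp g ?Y \<cdot> amap (ihom_fun E A) k) \<boxtimes> Id E B)" .
  qed (simp_all add: homI)
qed

lemma aug_precomp:
  assumes \<eta>: "\<eta> \<in> hom E \<I> B" and g: "g \<in> hom E B A" and [simp]: "X \<in> Obj E"
  shows "aug B \<eta> X \<cdot> precomp g X = aug A (g \<cdot> \<eta>) X"
proof -
  note [simp] = homD[OF \<eta>] homD[OF g]
  have "aug B \<eta> X \<cdot> precomp g X =
      (ev E B X \<cdot> (precomp g X \<boxtimes> Id E B)) \<cdot> coaug \<eta> (ihom E A X)"
    by (simp add: aug_comp[OF \<eta>])
  also have "\<dots> = ev E A X \<cdot> ((Id E (ihom E A X) \<boxtimes> g) \<cdot> coaug \<eta> (ihom E A X))"
    using precomp_arrow(4)[of g X] by simp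
  also have "\<dots> = aug A (g \<cdot> \<eta>) X"
    using aug_coaug[of "g \<cdot> \<eta>" A X] by (simp add: coaug_comp homI)
  finally show ?thesis .
qed

text \<open>
  Under the isomorphism of functors the identity of \<open>carr R\<close>, as a global element of
  \<open>Hom(carr R, carr R)\<close>, goes to that of an arrow \<open>f : carr S \<rightarrow> carr R\<close>; compatibility with the
  augmentations says that \<open>f\<close> preserves the units.
\<close>
lemma unital_map_of_mapping_iso:
  assumes R: "R \<in> solid_monoids E" and S: "S \<in> solid_monoids E"
    and iso: "(mapping_of E R, mapping_of E S) \<in> mapping_iso E"
  obtains f where "f \<in> hom E (carr S) (carr R)" "f \<cdot> unit S = unit R"
proof -
  interpret R: closed_idempotent_object E "carr R" "unit R"
    using R by (rule solid_monoid_closed_idempotent)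
  interpret S: closed_idempotent_object E "carr S" "unit S"
    using S by (rule solid_monoid_closed_idempotent)
  obtain t where t: "nat_trans E E (ihom_fun E (carr R)) (ihom_fun E (carr S)) t"
    and eq: "\<And>X. X \<in> Obj E \<Longrightarrow> aug (carr S) (unit S) X \<cdot> t X = aug (carr R) (unit R) X"
    using iso by (auto simp: mapping_iso_def colocalization_iso_rel_def mapping_of_aug)
  let ?A = "carr R" and ?B = "carr S"
  note [simp] = nat_trans_arrow[OF t] aug_arrow[OF S.unit_hom]
  let ?h = "t ?A \<cdot> point ?A (Id E ?A)"
  have "?h \<in> hom E \<I> (ihom E ?B ?A)" by (simp add: homI)
  then obtain f where f: "f \<in> hom E ?B ?A" and h: "point ?B f = ?h"
    by (rule point_surj[rotated 2]) simp_all
  have "f \<cdot> unit S = f \<cdot> (aug ?B (unit S) ?B \<cdot> point ?B (Id E ?B))"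
    by (simp add: aug_point_Id[OF S.unit_hom])
  also have "\<dots> = aug ?B (unit S) ?A \<cdot> ?h"
    using augmentation_point[OF _ aug_nat_trans[OF S.unit_hom] f] by (simp add: h)
  also have "\<dots> = (aug ?B (unit S) ?A \<cdot> t ?A) \<cdot> point ?A (Id E ?A)" by simp
  also have "\<dots> = unit R" by (simp add: eq aug_point_Id[OF R.unit_hom])
  finally show ?thesis using f that by blast
qed

lemma mapping_of_iso_iff:
  assumes R: "R \<in> solid_monoids E" and S: "S \<in> solid_monoids E"
  shows "(mapping_of E R, mapping_of E S) \<in> mapping_iso E \<longleftrightarrow> (R, S) \<in> solid_iso E"
proof
  assume iso: "(mapping_of E R, mapping_of E S) \<in> mapping_iso E"
  then have iso': "(mapping_of E S, mapping_of E R) \<in> mapping_iso E"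
    using equiv_mapping_iso by (meson equiv_def symE)
  obtain g where "g \<in> hom E (carr S) (carr R)" "g \<cdot> unit S = unit R"
    by (rule unital_map_of_mapping_iso[OF R S iso])
  moreover obtain f where "f \<in> hom E (carr R) (carr S)" "f \<cdot> unit R = unit S"
    by (rule unital_map_of_mapping_iso[OF S R iso'])
  ultimately show "(R, S) \<in> solid_iso E" by (intro solid_iso_if_unital_maps[OF R S])
next
  assume "(R, S) \<in> solid_iso E"
  then obtain f where f: "f \<in> hom E (carr R) (carr S)" "iso E f" and eq: "f \<cdot> unit R = unit S"
    by (rule solid_isoE)
  interpret R: closed_idempotent_object E "carr R" "unit R"
    using R by (rule solid_monoid_closed_idempotent)
  interpret S: closed_idempotent_object E "carr S" "unit S"
    using S by (rule solid_monoid_closed_idempotent)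
  note [simp] = homD[OF f(1)] f(2)
  let ?g = "inv_arrow E f"
  have g: "?g \<in> hom E (carr S) (carr R)" by (simp add: homI)
  have gu: "?g \<cdot> unit S = unit R" by (simp add: eq[symmetric])
  have "iso E (precomp ?g X)" if "X \<in> Obj E" for X
    by (rule isoI[of _ "ihom E (carr R) X" "ihom E (carr S) X" "precomp f X"])
       (use that precomp_inverse[OF f(1) g, of X] precomp_inverse[OF g f(1), of X]
         in \<open>simp_all add: homI\<close>)
  then have "(mapping_of E R, mapping_of E S) \<in> colocalization_iso_rel E"
    using R.colocalization_aug S.colocalization_aug precomp_nat_trans[OF g] aug_precomp[OF S.unit_hom g]
    by (auto simp: colocalization_iso_rel_def mapping_of_aug gu)
  then show "(mapping_of E R, mapping_of E S) \<in> mapping_iso E"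
    using mapping_of_colocalization[OF R] mapping_of_colocalization[OF S] by (simp add: mapping_iso_def)
qed

text \<open>
  By \<open>augmentation_point\<close>, the augmentation at \<open>Hom(A, Z)\<close> is restriction along \<open>\<eta>\<close> of arrows
  \<open>A \<rightarrow> Hom(A, Z)\<close>. As it is invertible, every arrow \<open>\<I> \<rightarrow> Hom(A, Z)\<close> extends uniquely
  along \<open>\<eta>\<close>; equivalently, precomposition with \<open>\<eta> \<boxtimes> Id E A\<close> is a bijection from
  arrows \<open>A \<otimes> A \<rightarrow> Z\<close> to arrows \<open>\<I> \<otimes> A \<rightarrow> Z\<close>, for every \<open>Z\<close>. Hence \<open>\<eta> \<boxtimes> Id E A\<close> is invertible.
\<close>
lemma mapping_colocalization_idempotent:
  assumes A [simp]: "A \<in> Obj E" and loc: "colocalization E (ihom_fun E A, c)"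
  shows "idempotent_object E A (c A \<cdot> point A (Id E A))"
proof
  let ?\<eta> = "c A \<cdot> point A (Id E A)"
  have c: "nat_trans E E (ihom_fun E A) id_fun c"
    and iso [simp]: "\<And>Z. Z \<in> Obj E \<Longrightarrow> iso E (c (ihom E A Z))"
    using loc by (auto simp: colocalization_def)
  note [simp] = nat_trans_arrow[OF c]
  have [simp]: "omap id_fun X = X" for X :: 'a by (simp add: id_fun_def)
  show \<eta>: "?\<eta> \<in> hom E \<I> A" by (simp add: homI)
  define \<eta> where "\<eta> = ?\<eta>"
  note [simp] = homD[OF \<eta>, folded \<eta>_def]
  have restrict: "c X \<cdot> point A f = f \<cdot> \<eta>" if "f \<in> hom E A X" for f X
    unfolding \<eta>_def by (rule augmentation_point[OF A c that])
  have extend: "\<exists>f \<in> hom E A (ihom E A Z). f \<cdot> \<eta> = u"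
    if [simp]: "Z \<in> Obj E" and u: "u \<in> hom E \<I> (ihom E A Z)" for Z u
  proof -
    note [simp] = homD[OF u]
    let ?v = "inv_arrow E (c (ihom E A Z)) \<cdot> u"
    have "?v \<in> hom E \<I> (ihom E A (ihom E A Z))" by (simp add: homI)
    then obtain f where f: "f \<in> hom E A (ihom E A Z)" and v: "point A f = ?v"
      by (rule point_surj[rotated 2]) simp_all
    note [simp] = homD[OF f]
    have "f \<cdot> \<eta> = c (ihom E A Z) \<cdot> ?v" using restrict[OF f] by (simp add: v)
    then show ?thesis using f by auto
  qed
  have unique: "f = g"
    if [simp]: "Z \<in> Obj E" and f: "f \<in> hom E A (ihom E A Z)" and g: "g \<in> hom E A (ihom E A Z)"
      and eq: "f \<cdot> \<eta> = g \<cdot> \<eta>" for Z f g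
  proof (rule point_inj)
    note [simp] = homD[OF f] homD[OF g]
    have eq': "c (ihom E A Z) \<cdot> point A f = c (ihom E A Z) \<cdot> point A g"
      using restrict[OF f] restrict[OF g] eq by simp
    show "point A f = point A g" by (rule iso_cancel_left[OF _ _ _ _ _ eq']) simp_all
    show "f \<in> Arr E" "g \<in> Arr E" "Dom E f = A" "Dom E g = A" "Cod E g = Cod E f" by simp_all
  qed
  \<comment> \<open>The inverse of \<open>\<eta> \<boxtimes> Id E A\<close> is the extension, in uncurried form, of the identity of \<open>\<I> \<otimes> A\<close>;
    that it is also a right inverse follows from uniqueness for arrows \<open>A \<otimes> A \<rightarrow> A \<otimes> A\<close>.\<close>
  let ?Z = "\<I> \<otimes> A"
  let ?u = "curry_arrow E \<I> A ?Z (Id E ?Z)"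
  have "?u \<in> hom E \<I> (ihom E A ?Z)" by (simp add: homI)
  then obtain k where k: "k \<in> hom E A (ihom E A ?Z)" and ku: "k \<cdot> \<eta> = ?u"
    using extend[of ?Z ?u] by auto
  note [simp] = homD[OF k]
  let ?h = "ev E A ?Z \<cdot> (k \<boxtimes> Id E A)"
  have left: "?h \<cdot> (\<eta> \<boxtimes> Id E A) = Id E ?Z" by (simp add: merge ku)
  let ?e = "(\<eta> \<boxtimes> Id E A) \<cdot> ?h"
  let ?W = "A \<otimes> A"
  let ?c = "\<lambda>x. curry_arrow E A A ?W x"
  have curry_eta: "?c x \<cdot> \<eta> = curry_arrow E \<I> A ?W (x \<cdot> (\<eta> \<boxtimes> Id E A))"
    if x: "x \<in> hom E ?W ?W" for x
  proof (rule ev_cancel[of A ?W _ \<I>])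
    note [simp] = homD[OF x]
    have "ev E A ?W \<cdot> ((?c x \<cdot> \<eta>) \<boxtimes> Id E A) = (ev E A ?W \<cdot> (?c x \<boxtimes> Id E A)) \<cdot> (\<eta> \<boxtimes> Id E A)"
      by (simp add: merge del: curry_arrow(4))
    then show "ev E A ?W \<cdot> ((?c x \<cdot> \<eta>) \<boxtimes> Id E A) =
        ev E A ?W \<cdot> (curry_arrow E \<I> A ?W (x \<cdot> (\<eta> \<boxtimes> Id E A)) \<boxtimes> Id E A)" by simp
    show "?c x \<cdot> \<eta> \<in> hom E \<I> (ihom E A ?W)"
      "curry_arrow E \<I> A ?W (x \<cdot> (\<eta> \<boxtimes> Id E A)) \<in> hom E \<I> (ihom E A ?W)" by (simp_all add: homI)
  qed simp_all
  have e: "?e \<in> hom E ?W ?W" by (simp add: homI)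
  have "?e \<cdot> (\<eta> \<boxtimes> Id E A) = (\<eta> \<boxtimes> Id E A) \<cdot> (?h \<cdot> (\<eta> \<boxtimes> Id E A))" by simp
  also have "\<dots> = Id E ?W \<cdot> (\<eta> \<boxtimes> Id E A)" unfolding left by simp
  finally have "?c ?e \<cdot> \<eta> = ?c (Id E ?W) \<cdot> \<eta>"
    unfolding curry_eta[OF e] curry_eta[OF Id_in_hom[OF tensor_in_Obj[OF A A]]] by simp
  then have ceq: "?c ?e = ?c (Id E ?W)"
    by (rule unique[rotated -1, of _ _ ?W]) (simp_all add: homI)
  have "?e = ev E A ?W \<cdot> (?c ?e \<boxtimes> Id E A)" by (rule curry_arrow(4)[symmetric]) simp_all
  also have "\<dots> = Id E ?W" unfolding ceq by simp
  finally have right: "?e = Id E ?W" .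
  have "iso E (\<eta> \<boxtimes> Id E A)"
    by (rule isoI[OF _ _ left right]) (simp_all add: homI)
  then show "iso E (?\<eta> \<boxtimes> Id E A)" by (simp only: \<eta>_def)
qed

text \<open>
  The given augmentation need not be evaluation at \<open>\<eta>\<close>, but both make \<open>Hom(A, -)\<close> a
  colocalization, so \<open>colocalization_unique_for_functor\<close> applies.
\<close>
lemma mapping_colocalization_is_mapping_of:
  assumes "p \<in> mapping_colocalizations E"
  shows "\<exists>R \<in> solid_monoids E. (mapping_of E R, p) \<in> mapping_iso E"
proof -
  obtain C c A where p: "p = (C, c)" and loc: "colocalization E (C, c)"
    and A: "A \<in> Obj E" and eq: "eq_functor E C (ihom_fun E A)"
    using assms by (auto simp: mapping_colocalizations_def)
  have loc': "colocalization E (ihom_fun E A, c)" by (rule colocalization_cong[OF eq loc])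
  interpret idempotent_object E A "c A \<cdot> point A (Id E A)"
    by (rule mapping_colocalization_idempotent[OF A loc'])
  have mem: "mapping_of E solid_monoid \<in> mapping_colocalizations E"
    by (rule mapping_of_colocalization[OF solid_monoid_solid])
  then have loc'': "colocalization E (mapping_of E solid_monoid)"
    by (auto simp: mapping_colocalizations_def)
  have p': "(ihom_fun E A, c) \<in> mapping_colocalizations E"
    using loc' A by (auto simp: mapping_colocalizations_def eq_functor_def)
  have "(mapping_of E solid_monoid, (ihom_fun E A, c)) \<in> mapping_iso E"
    using colocalization_unique_for_functor[OF _ loc', of "aug A (c A \<cdot> point A (Id E A))"] loc'' mem p'
    by (simp add: mapping_iso_def mapping_of_aug)
  moreover have "((ihom_fun E A, c), p) \<in> mapping_iso E"
    using colocalization_iso_rel_cong[OF eq loc] assms p' by (simp add: mapping_iso_def p)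
  ultimately have "(mapping_of E solid_monoid, p) \<in> mapping_iso E"
    using equiv_mapping_iso by (meson equiv_def transE)
  then show ?thesis using solid_monoid_solid by blast
qed

end

section \<open>The correspondence on isomorphism classes\<close>

lemma bij_betw_quotients:
  assumes r: "equiv A r" and s: "equiv B s" and map: "\<And>a. a \<in> A \<Longrightarrow> f a \<in> B"
    and iff: "\<And>a a'. a \<in> A \<Longrightarrow> a' \<in> A \<Longrightarrow> (f a, f a') \<in> s \<longleftrightarrow> (a, a') \<in> r"
    and surj: "\<And>b. b \<in> B \<Longrightarrow> \<exists>a \<in> A. (f a, b) \<in> s"
  obtains \<Phi> where "bij_betw \<Phi> (A // r) (B // s)" "\<And>a. a \<in> A \<Longrightarrow> \<Phi> (r `` {a}) = s `` {f a}"
proof -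
  define \<Phi> where "\<Phi> = (\<lambda>X. s `` (f ` X))"
  have \<Phi>: "\<Phi> (r `` {a}) = s `` {f a}" if a: "a \<in> A" for a
  proof -
    have "s `` {f a'} = s `` {f a}" if "(a, a') \<in> r" for a'
      using that a iff[of a a'] equiv_class_eq[OF s, of "f a" "f a'"] equivE[OF r]
      by (metis equiv_class_eq_iff r)
    moreover have "(a, a) \<in> r" using r a by (meson equiv_def refl_onD)
    ultimately show ?thesis unfolding \<Phi>_def by blast
  qed
  have "bij_betw \<Phi> (A // r) (B // s)"
  proof (rule bij_betw_imageI)
    show "inj_on \<Phi> (A // r)"
    proof (rule inj_onI)
      fix X Y assume "X \<in> A // r" "Y \<in> A // r" and eq: "\<Phi> X = \<Phi> Y"
      then obtain a b where ab: "a \<in> A" "b \<in> A" "X = r `` {a}" "Y = r `` {b}"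
        by (auto elim!: quotientE)
      then have "(f a, f b) \<in> s" using eq \<Phi> map s by (metis eq_equiv_class)
      then show "X = Y" using ab iff r by (simp add: equiv_class_eq)
    qed
    show "\<Phi> ` (A // r) = B // s"
    proof
      show "\<Phi> ` (A // r) \<subseteq> B // s" using \<Phi> by (auto elim!: quotientE intro!: quotientI map)
      show "B // s \<subseteq> \<Phi> ` (A // r)"
      proof
        fix Y assume "Y \<in> B // s"
        then obtain b where b: "b \<in> B" "Y = s `` {b}" by (auto elim: quotientE)
        with surj obtain a where a: "a \<in> A" "(f a, b) \<in> s" by blast
        then have "Y = \<Phi> (r `` {a})" using b \<Phi> s by (simp add: equiv_class_eq)
        then show "Y \<in> \<Phi> ` (A // r)" using a by (blast intro: quotientI)
      qed
    qed
  qed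
  then show ?thesis using \<Phi> that by blast
qed

theorem theorem3p3:
  fixes E :: "('o, 'm) csm_category"
  assumes "closed_symmetric_monoidal_category E"
    and "cocomplete TYPE('s) E"
  shows "equiv (solid_monoids E) (solid_iso E) \<and>
    equiv (smashing_localizations E) (smashing_iso E) \<and>
    equiv (mapping_colocalizations E) (mapping_iso E) \<and>
    (\<exists>\<Phi> \<Psi>.
      bij_betw \<Phi> (solid_monoids E // solid_iso E) (smashing_localizations E // smashing_iso E) \<and>
      bij_betw \<Psi> (solid_monoids E // solid_iso E) (mapping_colocalizations E // mapping_iso E) \<and>
      (\<forall>R \<in> solid_monoids E.
         \<Phi> (solid_iso E `` {R}) = smashing_iso E `` {smashing_of E R} \<and>
         \<Psi> (solid_iso E `` {R}) = mapping_iso E `` {mapping_of E R}))"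
proof -
  interpret closed_symmetric_monoidal_category E by (rule assms(1))
  obtain \<Phi> where \<Phi>:
    "bij_betw \<Phi> (solid_monoids E // solid_iso E) (smashing_localizations E // smashing_iso E)"
    "\<And>R. R \<in> solid_monoids E \<Longrightarrow> \<Phi> (solid_iso E `` {R}) = smashing_iso E `` {smashing_of E R}"
    using bij_betw_quotients[OF equiv_solid_iso equiv_smashing_iso smashing_of_localization
        smashing_of_iso_iff smashing_localization_is_smashing_of]
    by blast
  obtain \<Psi> where \<Psi>:
    "bij_betw \<Psi> (solid_monoids E // solid_iso E) (mapping_colocalizations E // mapping_iso E)"
    "\<And>R. R \<in> solid_monoids E \<Longrightarrow> \<Psi> (solid_iso E `` {R}) = mapping_iso E `` {mapping_of E R}"
    using bij_betw_quotients[OF equiv_solid_iso equiv_mapping_iso mapping_of_colocalization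
        mapping_of_iso_iff mapping_colocalization_is_mapping_of]
    by blast
  show ?thesis
    using equiv_solid_iso equiv_smashing_iso equiv_mapping_iso \<Phi> \<Psi> by blast
qed

end
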